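(* Fix integers $r,s \ge 1$ satisfying $r+s \ge 3$. Let $X = X_{n,r,s,p}$ denote the number of $(r,s)$-sums in $[n]_p$, i.e. the number of $(r+s)$-element subsets $\{x_1,\dots,x_r,y_1,\dots,y_s\} \subseteq [n]_p$ satisfying $x_1 + \cdots + x_r = y_1 + \cdots + y_s$, and let $\mu = \mathbb{E} X$. Then for every $\varepsilon > 0$ there are constants $c, C > 0$ and $n_0$ (depending only on $\varepsilon, r, s$) such that for all $n \ge n_0$ and all $p \in (0,1]$ satisfying $1 \le (1+\varepsilon)\mu \le X_{n,r,s,1}$ we have $$\exp\Bigl(-C\min\bigl\{\mu,\; \mu^{1/(r+s-1)}\log(1/p)\bigr\}\Bigr) \le \mathbb{P}(X \ge (1+\varepsilon)\mu) \le \exp\Bigl(-c\min\bigl\{\mu,\; \mu^{1/(r+s-1)}\log(1/p)\bigr\}\Bigr).$$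
   Context: $[n] = \{1,\dots,n\}$, and $[n]_p$ is the binomial random subset of $[n]$ in which each integer is included independently with probability $p$. An $(r+s)$-element subset is counted (once) if its elements can be labelled $x_1,\dots,x_r,y_1,\dots,y_s$ so that the given equation holds. $X_{n,r,s,1}$ is the (deterministic) value for $p=1$, i.e. the total number of such $(r+s)$-element subsets of $[n]$. *)

theory Defs
  imports "HOL-Probability.Probability"
begin

definition binomial_random_subset :: "nat \<Rightarrow> real \<Rightarrow> nat set pmf" where
  "binomial_random_subset n p =
     map_pmf (\<lambda>b. {i \<in> {1..n}. b i}) (Pi_pmf {1..n} False (\<lambda>_. bernoulli_pmf p))"

text \<open>
  Since the set must have exactly \<open>r + s\<close> elements, the labels \<open>x 1, \<dots>, x r, y 1, \<dots>, y s\<close>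
  are necessarily pairwise distinct.
\<close>

definition is_rs_sum :: "nat \<Rightarrow> nat \<Rightarrow> nat set \<Rightarrow> bool" where
  "is_rs_sum r s A \<longleftrightarrow> card A = r + s \<and>
     (\<exists>x y :: nat \<Rightarrow> nat. A = x ` {1..r} \<union> y ` {1..s} \<and> (\<Sum>i=1..r. x i) = (\<Sum>j=1..s. y j))"

definition num_rs_sums :: "nat \<Rightarrow> nat \<Rightarrow> nat set \<Rightarrow> nat" where
  "num_rs_sums r s S = card {A. A \<subseteq> S \<and> is_rs_sum r s A}"

definition expected_rs_sums :: "nat \<Rightarrow> nat \<Rightarrow> nat \<Rightarrow> real \<Rightarrow> real" where
  "expected_rs_sums n r s p =
     measure_pmf.expectation (binomial_random_subset n p) (\<lambda>S. real (num_rs_sums r s S))"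

end

theory Submission
  imports Defs
begin

text \<open>
  Put \<open>k = r + s\<close>. The solutions form a \<open>k\<close>-uniform hypergraph on \<open>{1..n}\<close> in which every
  \<open>(k - 1)\<close>-set lies in boundedly many edges and which has order \<open>n ^ (k - 1)\<close> edges.

  Upper bound: a moment of order \<open>l\<close> proportional to the rate shows that a large upper tail forces,
  up to probability \<open>exp (- c l)\<close>, a set of at most \<open>k l\<close> random elements that raises the
  conditional mean. By the codegree condition such a set must itself span a
  constant fraction of \<open>\<mu>\<close> edges. These clusters are too numerous for a plain union bound. Instead one
  explores a cluster step by step, adding an intersecting pair of edges or an edge meeting the
  explored part, and divides the expected number of exploration steps by the number
  of choices that every cluster is guaranteed to offer. Each step gains a factor
  \<open>p powr (1 / (2 (k - 1)))\<close>, and order \<open>\<mu> powr (1 / (k - 1))\<close> steps are possible.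

  Lower bound: either an initial interval of length of order \<open>\<mu> powr (1 / (k - 1))\<close> is contained in
  the random set, or, when \<open>\<mu>\<close> is small, the edges are split into about \<open>(1 + \<epsilon>) \<mu>\<close> classes
  and Harris' inequality bounds the probability that each class contributes an edge.
\<close>

section \<open>Expectation over a binomial random subset\<close>

text \<open>The expectation is kept as a finite weighted sum, so that it can be handled by induction
  on \<open>V\<close> without integrability conditions.\<close>

definition avg :: "real \<Rightarrow> 'a set \<Rightarrow> ('a set \<Rightarrow> real) \<Rightarrow> real" where
  "avg p V f = (\<Sum>S\<in>Pow V. p ^ card S * (1 - p) ^ card (V - S) * f S)"

lemma avg_empty [simp]: "avg p {} f = f {}"
  by (simp add: avg_def)

text \<open>Conditioning on one element: a subset of \<open>insert x V\<close> either avoids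
  \<open>x\<close> or is \<open>insert x S\<close> with \<open>S \<subseteq> V\<close>. This
  recursion drives the later inductions on \<open>V\<close>.\<close>

lemma avg_insert:
  assumes "finite V" "x \<notin> V"
  shows "avg p (insert x V) f = (1 - p) * avg p V f + p * avg p V (\<lambda>S. f (insert x S))"
proof -
  have disj: "Pow V \<inter> insert x ` Pow V = {}" using assms by auto
  have inj: "inj_on (insert x) (Pow V)" using assms(2) by (auto simp: inj_on_def)
  have a: "p ^ card S * (1 - p) ^ card (insert x V - S) * f S
      = (1 - p) * (p ^ card S * (1 - p) ^ card (V - S) * f S)" if "S \<in> Pow V" for S
  proof -
    have "insert x V - S = insert x (V - S)" using that assms by auto
    moreover have "card (insert x (V - S)) = Suc (card (V - S))" using assms by auto
    ultimately show ?thesis by simp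
  qed
  have b: "p ^ card (insert x S) * (1 - p) ^ card (insert x V - insert x S) * f (insert x S)
      = p * (p ^ card S * (1 - p) ^ card (V - S) * f (insert x S))" if "S \<in> Pow V" for S
  proof -
    have "insert x V - insert x S = V - S" using that assms by auto
    moreover have "card (insert x S) = Suc (card S)"
      using that assms by (auto simp: finite_subset card_insert_if)
    ultimately show ?thesis by simp
  qed
  have "avg p (insert x V) f
      = (\<Sum>S\<in>Pow V. p ^ card S * (1 - p) ^ card (insert x V - S) * f S)
        + (\<Sum>S\<in>insert x ` Pow V. p ^ card S * (1 - p) ^ card (insert x V - S) * f S)"
    unfolding avg_def Pow_insert using disj assms by (subst sum.union_disjoint) auto
  also have "(\<Sum>S\<in>insert x ` Pow V. p ^ card S * (1 - p) ^ card (insert x V - S) * f S)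
      = (\<Sum>S\<in>Pow V. p * (p ^ card S * (1 - p) ^ card (V - S) * f (insert x S)))"
    using inj b by (subst sum.reindex) (auto intro!: sum.cong)
  finally show ?thesis using a by (simp add: avg_def sum_distrib_left)
qed

lemma avg_add: "avg p V (\<lambda>S. f S + g S) = avg p V f + avg p V g"
  by (simp add: avg_def sum.distrib algebra_simps)

lemma avg_cmult: "avg p V (\<lambda>S. c * f S) = c * avg p V f"
  by (simp add: avg_def sum_distrib_left algebra_simps)

lemma avg_sum: "avg p V (\<lambda>S. \<Sum>i\<in>I. f i S) = (\<Sum>i\<in>I. avg p V (f i))"
  unfolding avg_def by (subst sum.swap) (simp add: sum_distrib_left)

lemma avg_mono:
  assumes "0 \<le> p" "p \<le> 1" "\<And>S. S \<subseteq> V \<Longrightarrow> f S \<le> g S"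
  shows "avg p V f \<le> avg p V g"
  unfolding avg_def using assms by (intro sum_mono mult_left_mono) auto

lemma avg_nonneg:
  assumes "0 \<le> p" "p \<le> 1" "\<And>S. S \<subseteq> V \<Longrightarrow> 0 \<le> f S"
  shows "0 \<le> avg p V f"
  unfolding avg_def using assms by (intro sum_nonneg mult_nonneg_nonneg) auto

lemma avg_cong:
  assumes "\<And>S. S \<subseteq> V \<Longrightarrow> f S = g S"
  shows "avg p V f = avg p V g"
  unfolding avg_def using assms by (intro sum.cong) auto

lemma avg_superset:
  assumes "finite V" "A \<subseteq> V"
  shows "avg p V (\<lambda>S. of_bool (A \<subseteq> S)) = p ^ card A"
  using assms
proof (induction V arbitrary: A rule: finite_induct)
  case (insert x V)
  show ?case
  proof (cases "x \<in> A")
    case True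
    have "avg p V (\<lambda>S. of_bool (A \<subseteq> S)) = avg p V (\<lambda>S. 0 * 0)"
      using True insert.hyps by (intro avg_cong) auto
    then have z: "avg p V (\<lambda>S. of_bool (A \<subseteq> S)) = 0" by (simp add: avg_def)
    have "avg p V (\<lambda>S. of_bool (A \<subseteq> insert x S)) = avg p V (\<lambda>S. of_bool (A - {x} \<subseteq> S))"
      by (intro avg_cong) auto
    also have "\<dots> = p ^ card (A - {x})" using insert.prems by (intro insert.IH) auto
    also have "p * \<dots> = p ^ card A"
      using True insert.prems insert.hyps
      by (metis card.remove finite.insertI finite_subset power_Suc)
    finally show ?thesis using z insert.hyps by (simp add: avg_insert)
  next
    case False
    have "avg p V (\<lambda>S. of_bool (A \<subseteq> insert x S)) = avg p V (\<lambda>S. of_bool (A \<subseteq> S))"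
      using False by (intro avg_cong) auto
    moreover have "avg p V (\<lambda>S. of_bool (A \<subseteq> S)) = p ^ card A"
      using False insert.prems by (intro insert.IH) auto
    ultimately show ?thesis using insert.hyps by (simp add: avg_insert algebra_simps)
  qed
qed simp

lemma avg_const: "finite V \<Longrightarrow> avg p V (\<lambda>S. c) = c"
  using avg_superset[of V "{}" p] avg_cmult[of p V c "\<lambda>S. 1"] by simp

text \<open>Condition on one element \<open>x\<close>. In each of the two cases the induction
  hypothesis applies; across them, both conditional means increase when \<open>x\<close> is added,
  so the covariance over the coin flip for \<open>x\<close> is nonnegative.\<close>

lemma avg_Harris:
  assumes "finite V" "0 \<le> p" "p \<le> 1" "mono f" "mono g"
  shows "avg p V f * avg p V g \<le> avg p V (\<lambda>S. f S * g S)"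
  using assms(1,4,5)
proof (induction V arbitrary: f g rule: finite_induct)
  case (insert x V)
  let ?f1 = "\<lambda>S. f (insert x S)" and ?g1 = "\<lambda>S. g (insert x S)"
  define a b c d where "a = avg p V f" and "b = avg p V ?f1" and "c = avg p V g" and "d = avg p V ?g1"
  have m: "mono ?f1" "mono ?g1"
    by (auto intro!: monoI monoD[OF insert.prems(1)] monoD[OF insert.prems(2)])
  have ab: "a \<le> b" unfolding a_def b_def
    using assms insert.prems by (intro avg_mono) (auto intro: monoD)
  have cd: "c \<le> d" unfolding c_def d_def
    using assms insert.prems by (intro avg_mono) (auto intro: monoD)
  \<comment> \<open>The subtracted term is the covariance of two variables that take the values
    \<open>a\<close>, \<open>c\<close> with probability \<open>1 - p\<close> and \<open>b\<close>,
    \<open>d\<close> with probability \<open>p\<close>.\<close>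
  have "((1 - p) * a + p * b) * ((1 - p) * c + p * d)
      = (1 - p) * (a * c) + p * (b * d) - p * (1 - p) * ((b - a) * (d - c))"
    by (simp add: algebra_simps)
  also have "\<dots> \<le> (1 - p) * (a * c) + p * (b * d)"
    using ab cd assms by simp
  also have "\<dots> \<le> (1 - p) * avg p V (\<lambda>S. f S * g S) + p * avg p V (\<lambda>S. ?f1 S * ?g1 S)"
    unfolding a_def b_def c_def d_def
    using assms insert.IH[OF insert.prems] insert.IH[OF m]
    by (intro add_mono mult_left_mono) auto
  finally show ?case using insert.hyps by (simp add: avg_insert a_def b_def c_def d_def)
qed simp

text \<open>Nonnegativity makes partial products monotone again, so the inequality for two functions
  can be iterated.\<close>

lemma avg_Harris_prod:
  fixes f :: "'i \<Rightarrow> 'a set \<Rightarrow> real"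
  assumes "finite V" "0 \<le> p" "p \<le> 1" "finite I"
    "\<And>i. i \<in> I \<Longrightarrow> mono (f i)" "\<And>i S. i \<in> I \<Longrightarrow> 0 \<le> f i S"
  shows "(\<Prod>i\<in>I. avg p V (f i)) \<le> avg p V (\<lambda>S. \<Prod>i\<in>I. f i S)"
  using assms(4-6)
proof (induction I rule: finite_induct)
  case empty
  then show ?case using assms(1) by (simp add: avg_const)
next
  case (insert i I)
  have mono: "mono (\<lambda>S. \<Prod>i\<in>I. f i S)"
    using insert.prems by (intro monoI prod_mono) (auto dest: monoD)
  have "(\<Prod>i\<in>insert i I. avg p V (f i)) \<le> avg p V (f i) * avg p V (\<lambda>S. \<Prod>i\<in>I. f i S)"
    using insert assms(1-3) by (auto intro!: mult_left_mono avg_nonneg)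
  also have "\<dots> \<le> avg p V (\<lambda>S. f i S * (\<Prod>i\<in>I. f i S))"
    using insert assms(1-3) mono by (intro avg_Harris) auto
  finally show ?case using insert by simp
qed

text \<open>\<open>Pi_pmf\<close> over \<open>insert x V\<close> is a coin flip for \<open>x\<close>
  combined with an independent choice on \<open>V\<close>, which is the recursion of
  \<open>avg_insert\<close>.\<close>

lemma expectation_binomial_random_subset:
  assumes "0 \<le> p" "p \<le> 1"
  shows "measure_pmf.expectation (binomial_random_subset n p) f = avg p {1..n} f"
proof -
  let ?M = "\<lambda>V. Pi_pmf V False (\<lambda>_::nat. bernoulli_pmf p)"
  have fin: "finite (set_pmf (?M V))" if "finite V" for V
    using that by (subst set_Pi_pmf) (auto intro!: finite_PiE_dflt)
  have "measure_pmf.expectation (?M V) (\<lambda>b. f {i\<in>V. b i}) = avg p V f" if "finite V" for V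
    using that
  proof (induction V arbitrary: f rule: finite_induct)
    case (insert x V)
    have e: "{i \<in> insert x V. (g(x := True)) i} = insert x {i\<in>V. g i}"
      "{i \<in> insert x V. (g(x := False)) i} = {i\<in>V. g i}" for g
      using insert.hyps by auto
    define h where "h b = measure_pmf.expectation (?M V) (\<lambda>g. f {i \<in> insert x V. (g(x := b)) i})" for b
    have "measure_pmf.expectation (?M (insert x V)) (\<lambda>b. f {i\<in>insert x V. b i})
      = measure_pmf.expectation (bernoulli_pmf p \<bind> (\<lambda>b. map_pmf (\<lambda>g. g(x := b)) (?M V)))
         (\<lambda>b. f {i\<in>insert x V. b i})"
      using insert.hyps by (subst Pi_pmf_insert') (auto simp: map_pmf_def)
    also have "\<dots> = (\<Sum>b\<in>UNIV. pmf (bernoulli_pmf p) b * h b)"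
      using insert.hyps fin unfolding h_def
      by (subst pmf_expectation_bind[where A=UNIV]) auto
    also have "\<dots> = p * h True + (1 - p) * h False"
      using assms by (simp add: UNIV_bool)
    also have "h True = measure_pmf.expectation (?M V) (\<lambda>b. f (insert x {i\<in>V. b i}))"
      by (simp only: h_def e)
    also have "h False = measure_pmf.expectation (?M V) (\<lambda>b. f {i\<in>V. b i})"
      by (simp only: h_def e)
    finally show ?case
      using insert.hyps insert.IH[of f] insert.IH[of "\<lambda>S. f (insert x S)"] by (simp add: avg_insert)
  qed simp
  from this[of "{1..n}"] show ?thesis by (simp add: binomial_random_subset_def)
qed

lemma prob_binomial_random_subset:
  assumes "0 \<le> p" "p \<le> 1"
  shows "measure_pmf.prob (binomial_random_subset n p) E = avg p {1..n} (\<lambda>S. of_bool (S \<in> E))"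
proof -
  have "measure_pmf.prob (binomial_random_subset n p) E
      = measure_pmf.expectation (binomial_random_subset n p) (indicator E)" by simp
  also have "indicator E = (\<lambda>S. of_bool (S \<in> E) :: real)" by (auto simp: indicator_def)
  finally show ?thesis using assms by (simp add: expectation_binomial_random_subset)
qed

section \<open>Hypergraphs of bounded codegree\<close>

locale codegree_hypergraph =
  fixes V :: "'a set" and H :: "'a set set" and k K :: nat and p :: real
  assumes finite_V: "finite V"
    and edge_subset: "A \<in> H \<Longrightarrow> A \<subseteq> V"
    and card_edge: "A \<in> H \<Longrightarrow> card A = k"
    and codegree: "T \<subseteq> V \<Longrightarrow> card T = k - 1 \<Longrightarrow> card {A \<in> H. T \<subseteq> A} \<le> K"
    and k_ge_2: "2 \<le> k"
    and p_pos: "0 < p" and p_le_1: "p \<le> 1"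
begin

definition e :: "'a set \<Rightarrow> nat" where
  "e U = card {A \<in> H. A \<subseteq> U}"

definition \<mu> :: real where
  "\<mu> = card H * p ^ k"

text \<open>An a priori bound for \<open>\<mu>\<close>: the codegree condition allows at most
  \<open>K * card V ^ (k - 1)\<close> edges. Weights are estimated by fractions of
  \<open>\<nu>\<close>, and an assumption \<open>\<nu> \<le> B * \<mu>\<close> later converts them
  to \<open>\<mu>\<close>.\<close>

definition \<nu> :: real where
  "\<nu> = K * card V ^ (k - 1) * p ^ k"

definition np :: real where
  "np = card V * p"

section \<open>Edge counts relative to a fixed vertex set\<close>

lemma finite_H: "finite H"
  by (rule finite_subset[of _ "Pow V"]) (auto simp: finite_V dest: edge_subset)

lemma finite_edge: "A \<in> H \<Longrightarrow> finite A"
  using edge_subset finite_V finite_subset by blast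

lemma np_nonneg: "0 \<le> np" and \<mu>_nonneg: "0 \<le> \<mu>" and \<nu>_nonneg: "0 \<le> \<nu>"
  using p_pos by (simp_all add: np_def \<mu>_def \<nu>_def)

text \<open>Choosing \<open>S\<close> in \<open>Z\<close> and \<open>T\<close> in \<open>V\<close>
  fixes \<open>k - 1\<close> vertices of the edge, after which the codegree condition leaves at most
  \<open>K\<close> edges.\<close>

lemma card_edges_through:
  assumes "Z \<subseteq> V" "a + b = k - 1"
  shows "card {A \<in> H. \<exists>S T. S \<subseteq> Z \<inter> A \<and> card S = a \<and> T \<subseteq> A \<and> card T = b \<and> S \<inter> T = {}}
    \<le> K * card Z ^ a * card V ^ b" (is "card ?G \<le> _")
proof -
  have finZ: "finite Z" using assms finite_V finite_subset by blast
  define I where "I = {S. S \<subseteq> Z \<and> card S = a} \<times> {T. T \<subseteq> V \<and> card T = b}"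
  define J where "J = {(S, T) \<in> I. S \<inter> T = {}}"
  have finI: "finite I" unfolding I_def using finZ finite_V by auto
  then have finJ: "finite J" unfolding J_def by (rule rev_finite_subset) auto
  have choose: "(m choose c) \<le> m ^ c" for m c :: nat
    by (cases "c \<le> m") (auto simp: binomial_le_pow binomial_eq_0)
  have "card J \<le> card I" unfolding J_def using finI by (intro card_mono) auto
  also have "\<dots> = (card Z choose a) * (card V choose b)"
    unfolding I_def by (simp add: card_cartesian_product n_subsets finZ finite_V)
  also have "\<dots> \<le> card Z ^ a * card V ^ b" by (intro mult_mono choose) auto
  finally have cardJ: "card J \<le> card Z ^ a * card V ^ b" .
  have "?G \<subseteq> (\<Union>(S, T)\<in>J. {A \<in> H. S \<union> T \<subseteq> A})"
  proof
    fix A assume "A \<in> ?G"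
    then obtain S T where "A \<in> H" "S \<subseteq> Z \<inter> A" "card S = a" "T \<subseteq> A" "card T = b" "S \<inter> T = {}"
      by blast
    moreover from this have "(S, T) \<in> J" using edge_subset unfolding J_def I_def by auto
    ultimately show "A \<in> (\<Union>(S, T)\<in>J. {A \<in> H. S \<union> T \<subseteq> A})" by auto
  qed
  then have "card ?G \<le> card (\<Union>(S, T)\<in>J. {A \<in> H. S \<union> T \<subseteq> A})"
    using finJ finite_H by (intro card_mono) auto
  also have "\<dots> \<le> (\<Sum>(S, T)\<in>J. card {A \<in> H. S \<union> T \<subseteq> A})"
    using card_UN_le[OF finJ, of "\<lambda>(S, T). {A \<in> H. S \<union> T \<subseteq> A}"] by (simp add: case_prod_unfold)
  also have "\<dots> \<le> (\<Sum>(S, T)\<in>J. K)"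
  proof (intro sum_mono, clarify)
    fix S T assume "(S, T) \<in> J"
    then have st: "S \<subseteq> Z" "card S = a" "T \<subseteq> V" "card T = b" "S \<inter> T = {}"
      by (auto simp: J_def I_def)
    then have "card (S \<union> T) = k - 1"
      using finZ finite_V assms by (subst card_Un_disjoint) (auto intro: finite_subset)
    then show "card {A \<in> H. S \<union> T \<subseteq> A} \<le> K"
      using st assms by (intro codegree) auto
  qed
  also have "\<dots> = card J * K" by simp
  also have "\<dots> \<le> K * card Z ^ a * card V ^ b" using cardJ by (simp add: mult.commute mult.assoc)
  finally show ?thesis .
qed

text \<open>Take all of \<open>A \<inter> Z\<close> for \<open>S\<close> and all but one vertex of
  \<open>A - Z\<close> for \<open>T\<close>; the codegree condition pays for the last
  vertex.\<close>

lemma card_edges_leaving: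
  assumes "Z \<subseteq> V" "1 \<le> j" "j \<le> k"
  shows "card {A \<in> H. card (A - Z) = j} \<le> K * card Z ^ (k - j) * card V ^ (j - 1)"
proof -
  have "{A \<in> H. card (A - Z) = j} \<subseteq>
    {A \<in> H. \<exists>S T. S \<subseteq> Z \<inter> A \<and> card S = k - j \<and> T \<subseteq> A \<and> card T = j - 1 \<and> S \<inter> T = {}}"
  proof clarify
    fix A assume A: "A \<in> H" "j = card (A - Z)"
    then have "card (A \<inter> Z) = k - card (A - Z)"
      using card_edge[OF A(1)] finite_edge[OF A(1)]
      by (metis Diff_Diff_Int Diff_subset card_Diff_subset finite_Diff)
    moreover obtain T where "T \<subseteq> A - Z" "card T = j - 1"
      using A by (meson diff_le_self obtain_subset_with_card_n)
    ultimately show "\<exists>S T. S \<subseteq> Z \<inter> A \<and> card S = k - card (A - Z) \<and> T \<subseteq> A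
        \<and> card T = card (A - Z) - 1 \<and> S \<inter> T = {}"
      using A by (intro exI[of _ "A \<inter> Z"] exI[of _ T]) auto
  qed
  then have "card {A \<in> H. card (A - Z) = j} \<le> card
    {A \<in> H. \<exists>S T. S \<subseteq> Z \<inter> A \<and> card S = k - j \<and> T \<subseteq> A \<and> card T = j - 1 \<and> S \<inter> T = {}}"
    using finite_H by (intro card_mono) auto
  also have "\<dots> \<le> K * card Z ^ (k - j) * card V ^ (j - 1)"
    using assms by (intro card_edges_through) auto
  finally show ?thesis .
qed

lemma e_le: assumes "Z \<subseteq> V" shows "e Z \<le> K * card Z ^ (k - 1)"
proof -
  have "{A \<in> H. A \<subseteq> Z} \<subseteq>
    {A \<in> H. \<exists>S T. S \<subseteq> Z \<inter> A \<and> card S = k - 1 \<and> T \<subseteq> A \<and> card T = 0 \<and> S \<inter> T = {}}"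
  proof clarify
    fix A assume A: "A \<in> H" "A \<subseteq> Z"
    obtain S where "S \<subseteq> A" "card S = k - 1"
      using card_edge[OF A(1)] by (metis diff_le_self obtain_subset_with_card_n)
    then show "\<exists>S T. S \<subseteq> Z \<inter> A \<and> card S = k - 1 \<and> T \<subseteq> A \<and> card T = 0 \<and> S \<inter> T = {}"
      using A by (intro exI[of _ S] exI[of _ "{}"]) auto
  qed
  then have "e Z \<le> card
    {A \<in> H. \<exists>S T. S \<subseteq> Z \<inter> A \<and> card S = k - 1 \<and> T \<subseteq> A \<and> card T = 0 \<and> S \<inter> T = {}}"
    unfolding e_def using finite_H by (intro card_mono) auto
  also have "\<dots> \<le> K * card Z ^ (k - 1) * card V ^ 0"
    using assms by (intro card_edges_through) auto
  finally show ?thesis by simp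
qed

lemma \<mu>_le_\<nu>: "\<mu> \<le> \<nu>"
proof -
  have "H = {A \<in> H. card (A - {}) = k}" using card_edge by auto
  then have "card H \<le> K * card V ^ (k - 1)"
    using card_edges_leaving[of "{}" k] k_ge_2 by simp
  then have "real (card H) \<le> real (K * card V ^ (k - 1))" by (simp only: of_nat_le_iff)
  then show ?thesis unfolding \<mu>_def \<nu>_def
    using p_pos by (auto intro!: mult_right_mono)
qed

text \<open>Group the edges by the number \<open>j\<close> of vertices outside \<open>Z\<close>:
  each group weighs at most \<open>\<nu> * (card Z / np) ^ (k - j)\<close>. Since
  \<open>j < k\<close> and \<open>card Z \<le> np\<close>, one factor \<open>card Z / np\<close>
  survives in every group.\<close>

lemma touching_weight:
  assumes "Z \<subseteq> V" "card Z \<le> np"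
  shows "(\<Sum>A | A \<in> H \<and> A \<inter> Z \<noteq> {} \<and> \<not> A \<subseteq> Z. p ^ card (A - Z)) \<le> k * \<nu> * (card Z / np)"
proof (cases "card Z = 0")
  case True
  then have "Z = {}" using assms finite_V by (metis card_0_eq finite_subset)
  then show ?thesis by simp
next
  case False
  define z where "z = card Z"
  have z: "1 \<le> z" "z \<le> np" using False assms by (auto simp: z_def)
  then have np: "np > 0" by linarith
  define T where "T = {A. A \<in> H \<and> A \<inter> Z \<noteq> {} \<and> \<not> A \<subseteq> Z}"
  have finT: "finite T" unfolding T_def using finite_H by auto
  have range: "card (A - Z) \<in> {1..k-1}" if "A \<in> T" for A
  proof -
    have A: "A \<in> H" "A \<inter> Z \<noteq> {}" "\<not> A \<subseteq> Z" using that by (auto simp: T_def)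
    have "card (A - Z) < card A" using A finite_edge by (intro psubset_card_mono) auto
    moreover have "card (A - Z) \<noteq> 0" using A finite_edge[of A] by auto
    ultimately show ?thesis using card_edge[OF A(1)] by auto
  qed
  have each: "(\<Sum>A | A \<in> T \<and> card (A - Z) = j. p ^ card (A - Z)) \<le> \<nu> * (z / np)"
    if j: "j \<in> {1..k-1}" for j
  proof -
    have "(\<Sum>A | A \<in> T \<and> card (A - Z) = j. p ^ card (A - Z))
      = real (card {A \<in> T. card (A - Z) = j}) * p ^ j" by simp
    also have "\<dots> \<le> real (card {A \<in> H. card (A - Z) = j}) * p ^ j"
      using finite_H p_pos by (intro mult_right_mono) (auto intro!: card_mono simp: T_def)
    also have "\<dots> \<le> real (K * z ^ (k - j) * card V ^ (j - 1)) * p ^ j"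
      using j assms p_pos card_edges_leaving[of Z j]
      unfolding z_def by (intro mult_right_mono) (auto simp del: of_nat_mult of_nat_power)
    also have "\<dots> = \<nu> * (z / np) ^ (k - j)"
    proof -
      have V: "card V > 0" using np by (auto simp: np_def zero_less_mult_iff)
      have "k - 1 = (j - 1) + (k - j)" using j by auto
      then have "card V ^ (k - 1) = card V ^ (j - 1) * card V ^ (k - j)"
        by (metis power_add)
      moreover have "k = j + (k - j)" using j by auto
      then have "p ^ k = p ^ j * p ^ (k - j)" by (metis power_add)
      ultimately show ?thesis using V p_pos
        by (simp add: \<nu>_def np_def power_divide power_mult_distrib)
    qed
    also have "\<dots> \<le> \<nu> * (z / np) ^ 1"
    proof (intro mult_left_mono power_decreasing)
      show "1 \<le> k - j" using j by auto
    qed (use z np \<nu>_nonneg in \<open>auto simp: field_simps\<close>)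
    finally show ?thesis by simp
  qed
  have "(\<Sum>A\<in>T. p ^ card (A - Z))
      = (\<Sum>j\<in>{1..k-1}. \<Sum>A | A \<in> T \<and> card (A - Z) = j. p ^ card (A - Z))"
    using finT range by (subst sum.group) auto
  also have "\<dots> \<le> (\<Sum>j\<in>{1..k-1}. \<nu> * (z / np))" by (intro sum_mono each)
  also have "\<dots> = (k - 1) * (\<nu> * (z / np))" using k_ge_2 by (simp add: of_nat_diff)
  also have "\<dots> \<le> k * (\<nu> * (z / np))"
    using \<nu>_nonneg np by (intro mult_right_mono) (auto intro!: mult_nonneg_nonneg)
  finally show ?thesis unfolding T_def z_def by (simp add: mult.assoc)
qed

subsection \<open>Moments and clusters\<close>

lemma real_e: "real (e S) = (\<Sum>A\<in>H. of_bool (A \<subseteq> S))"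
  using finite_H by (simp add: e_def Int_def)

lemma avg_e: "avg p V (\<lambda>S. real (e S)) = \<mu>"
proof -
  have "avg p V (\<lambda>S. real (e S)) = (\<Sum>A\<in>H. avg p V (\<lambda>S. of_bool (A \<subseteq> S)))"
    unfolding real_e avg_sum ..
  also have "\<dots> = (\<Sum>A\<in>H. p ^ k)"
    using edge_subset card_edge finite_V by (intro sum.cong) (auto simp: avg_superset)
  finally show ?thesis by (simp add: \<mu>_def)
qed

lemma power_card_Un:
  assumes "finite A" "finite B"
  shows "p ^ card (A \<union> B) = p ^ card A * p ^ card (B - A)"
proof -
  have "card (A \<union> B) = card A + card (B - A)"
    using assms by (metis Un_Diff_cancel card_Un_disjoint Diff_disjoint finite_Diff)
  then show ?thesis by (simp add: power_add)
qed

text \<open>The mean of \<open>e S\<close> conditional on \<open>U \<subseteq> S\<close>: an edge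
  \<open>A\<close> then only needs its vertices in \<open>A - U\<close>.\<close>

definition cond_mean :: "'a set \<Rightarrow> real" where
  "cond_mean U = (\<Sum>A\<in>H. p ^ card (A - U))"

definition no_seed :: "nat \<Rightarrow> real \<Rightarrow> 'a set \<Rightarrow> bool" where
  "no_seed L \<theta> S \<longleftrightarrow> (\<forall>U\<subseteq>S. card U \<le> L \<longrightarrow> cond_mean U \<le> \<theta>)"

text \<open>Adding edges one at a time, each new edge contributes a factor \<open>cond_mean U\<close>, where \<open>U\<close> is the
  union of the edges so far; on \<open>no_seed\<close> this factor is at most \<open>\<theta>\<close> as long as \<open>U\<close> is small.\<close>

lemma moment_bound:
  assumes "0 \<le> \<theta>" "U \<subseteq> V" "card U + k * l \<le> L"
  shows "avg p V (\<lambda>S. of_bool (U \<subseteq> S \<and> no_seed L \<theta> S) * real (e S) ^ l) \<le> p ^ card U * \<theta> ^ l"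
  using assms(2,3)
proof (induction l arbitrary: U)
  case 0
  have "avg p V (\<lambda>S. of_bool (U \<subseteq> S \<and> no_seed L \<theta> S) * real (e S) ^ 0) \<le> avg p V (\<lambda>S. of_bool (U \<subseteq> S))"
    using p_pos p_le_1 by (intro avg_mono) auto
  then show ?case using 0 finite_V by (simp add: avg_superset)
next
  case (Suc l)
  have finU: "finite U" using Suc.prems finite_V finite_subset by blast
  show ?case
  proof (cases "cond_mean U \<le> \<theta>")
    case True
    have "avg p V (\<lambda>S. of_bool (U \<subseteq> S \<and> no_seed L \<theta> S) * real (e S) ^ Suc l)
        = avg p V (\<lambda>S. \<Sum>A\<in>H. of_bool (U \<union> A \<subseteq> S \<and> no_seed L \<theta> S) * real (e S) ^ l)"
    proof (intro avg_cong)
      fix S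
      have "of_bool (U \<subseteq> S \<and> no_seed L \<theta> S) * real (e S) ^ Suc l
          = (\<Sum>A\<in>H. of_bool (A \<subseteq> S)) * (of_bool (U \<subseteq> S \<and> no_seed L \<theta> S) * real (e S) ^ l)"
        by (simp add: real_e)
      also have "\<dots> = (\<Sum>A\<in>H. of_bool (U \<union> A \<subseteq> S \<and> no_seed L \<theta> S) * real (e S) ^ l)"
        unfolding sum_distrib_right by (intro sum.cong) auto
      finally show "of_bool (U \<subseteq> S \<and> no_seed L \<theta> S) * real (e S) ^ Suc l = \<dots>" .
    qed
    also have "\<dots> = (\<Sum>A\<in>H. avg p V (\<lambda>S. of_bool (U \<union> A \<subseteq> S \<and> no_seed L \<theta> S) * real (e S) ^ l))"
      by (rule avg_sum)
    also have "\<dots> \<le> (\<Sum>A\<in>H. p ^ card (U \<union> A) * \<theta> ^ l)"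
    proof (intro sum_mono Suc.IH)
      fix A assume A: "A \<in> H"
      show "U \<union> A \<subseteq> V" using A Suc.prems edge_subset by auto
      show "card (U \<union> A) + k * l \<le> L"
        using card_Un_le[of U A] card_edge[OF A] Suc.prems by simp
    qed
    also have "\<dots> = p ^ card U * \<theta> ^ l * cond_mean U"
      unfolding cond_mean_def sum_distrib_left
      using finU finite_edge by (intro sum.cong) (auto simp: power_card_Un)
    also have "\<dots> \<le> p ^ card U * \<theta> ^ l * \<theta>"
      using True assms p_pos by (intro mult_left_mono) auto
    finally show ?thesis by (simp add: algebra_simps)
  next
    case False
    \<comment> \<open>Here \<open>U\<close> itself violates \<open>no_seed\<close>, so the event is
      impossible.\<close>
    have "card U \<le> L" using Suc.prems by simp
    then have "avg p V (\<lambda>S. of_bool (U \<subseteq> S \<and> no_seed L \<theta> S) * real (e S) ^ Suc l) = avg p V (\<lambda>S. 0)"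
      using False by (intro avg_cong) (auto simp: no_seed_def)
    then show ?thesis using assms p_pos finite_V by (simp add: avg_const)
  qed
qed

text \<open>Markov's inequality for the \<open>l\<close>-th power of \<open>e S\<close> restricted
  to \<open>no_seed\<close>, with the moment bound started at the empty set. A union of
  \<open>l\<close> edges has at most \<open>k * l\<close> vertices, hence the condition on
  \<open>L\<close>.\<close>

lemma tail_no_seed:
  fixes a :: real
  assumes "0 \<le> \<theta>" "0 < a" "k * l \<le> L"
  shows "avg p V (\<lambda>S. of_bool (a \<le> e S \<and> no_seed L \<theta> S)) \<le> (\<theta> / a) ^ l"
proof -
  have "avg p V (\<lambda>S. of_bool (a \<le> e S \<and> no_seed L \<theta> S))
    \<le> avg p V (\<lambda>S. (1 / a) ^ l * (of_bool ({} \<subseteq> S \<and> no_seed L \<theta> S) * real (e S) ^ l))"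
  proof (intro avg_mono)
    fix S
    have "1 \<le> (1 / a) ^ l * real (e S) ^ l" if "a \<le> e S"
      using that assms by (simp flip: power_mult_distrib)
    then show "of_bool (a \<le> e S \<and> no_seed L \<theta> S)
        \<le> (1 / a) ^ l * (of_bool ({} \<subseteq> S \<and> no_seed L \<theta> S) * real (e S) ^ l)"
      using assms by auto
  qed (use p_pos p_le_1 in auto)
  also have "\<dots> = (1 / a) ^ l * avg p V (\<lambda>S. of_bool ({} \<subseteq> S \<and> no_seed L \<theta> S) * real (e S) ^ l)"
    by (rule avg_cmult)
  also have "\<dots> \<le> (1 / a) ^ l * (p ^ card {} * \<theta> ^ l)"
    using moment_bound[of \<theta> "{}" l L] assms by (intro mult_left_mono) auto
  finally show ?thesis by (simp add: power_divide)
qed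

definition touching :: "'a set \<Rightarrow> 'a set set" where
  "touching Z = {A. A \<in> H \<and> A \<inter> Z \<noteq> {} \<and> \<not> A \<subseteq> Z}"

lemma finite_touching: "finite (touching Z)"
  using finite_H by (simp add: touching_def)

lemma touching_weight_le:
  assumes "Z \<subseteq> V" "card Z \<le> z" "z \<le> np"
  shows "(\<Sum>A\<in>touching Z. p ^ card (A - Z)) \<le> k * \<nu> * z / np"
proof -
  have "(\<Sum>A\<in>touching Z. p ^ card (A - Z)) \<le> k * \<nu> * (card Z / np)"
    unfolding touching_def using assms by (intro touching_weight) auto
  also have "\<dots> \<le> k * \<nu> * (z / np)"
    using assms \<nu>_nonneg np_nonneg by (intro mult_left_mono divide_right_mono) auto
  finally show ?thesis by simp
qed

text \<open>Edges disjoint from \<open>U\<close> contribute at most \<open>\<mu>\<close>, edges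
  inside \<open>U\<close> contribute \<open>1\<close> each, and edges partly inside have small
  weight. A raised conditional mean therefore forces \<open>U\<close> to span many edges.\<close>

lemma cond_mean_le:
  assumes "U \<subseteq> V" "card U \<le> L" "L \<le> np"
  shows "cond_mean U \<le> \<mu> + k * \<nu> * L / np + e U"
proof -
  have split: "H = {A \<in> H. A \<inter> U = {} \<and> \<not> A \<subseteq> U} \<union> touching U \<union> {A \<in> H. A \<subseteq> U}"
    by (auto simp: touching_def)
  have "cond_mean U = (\<Sum>A | A \<in> H \<and> A \<inter> U = {} \<and> \<not> A \<subseteq> U. p ^ card (A - U))
      + (\<Sum>A\<in>touching U. p ^ card (A - U)) + (\<Sum>A | A \<in> H \<and> A \<subseteq> U. p ^ card (A - U))"
    unfolding cond_mean_def
    by (subst split, subst sum.union_disjoint, use finite_H in \<open>auto simp: touching_def\<close>,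
        subst sum.union_disjoint, use finite_H in \<open>auto simp: touching_def\<close>)
  moreover have "(\<Sum>A | A \<in> H \<and> A \<inter> U = {} \<and> \<not> A \<subseteq> U. p ^ card (A - U)) \<le> \<mu>"
  proof -
    have "(\<Sum>A | A \<in> H \<and> A \<inter> U = {} \<and> \<not> A \<subseteq> U. p ^ card (A - U))
      = (\<Sum>A | A \<in> H \<and> A \<inter> U = {} \<and> \<not> A \<subseteq> U. p ^ k)"
      using card_edge by (intro sum.cong) (auto simp: Diff_triv)
    also have "\<dots> \<le> (\<Sum>A\<in>H. p ^ k)" using finite_H p_pos by (intro sum_mono2) auto
    finally show ?thesis by (simp add: \<mu>_def)
  qed
  moreover have "(\<Sum>A | A \<in> H \<and> A \<subseteq> U. p ^ card (A - U)) = (\<Sum>A | A \<in> H \<and> A \<subseteq> U. 1)"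
  proof (intro sum.cong refl)
    fix A assume "A \<in> {A \<in> H. A \<subseteq> U}"
    then have "A - U = {}" by auto
    then show "p ^ card (A - U) = 1" by (simp only: card.empty power_0)
  qed
  moreover have "\<dots> = real (e U)" by (simp add: e_def)
  ultimately show ?thesis using touching_weight_le[OF assms] by linarith
qed

section \<open>Clusters: small sets spanning many edges, explored from a known part
  \<open>Z\<close>\<close>

definition cluster :: "nat \<Rightarrow> real \<Rightarrow> 'a set \<Rightarrow> 'a set \<Rightarrow> bool" where
  "cluster L E Z S \<longleftrightarrow> (\<exists>U. Z \<subseteq> U \<and> U \<subseteq> S \<and> card U \<le> L \<and> E \<le> e U)"

text \<open>Split according to \<open>no_seed\<close> at level
  \<open>(1 + \<epsilon> / 2) * \<mu>\<close>. If it holds, the moment bound applies. Otherwise some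
  small set has a conditional mean above that level; edges partly inside it explain at most
  \<open>\<epsilon> / 4 * \<mu>\<close> of the excess, so it spans at least
  \<open>\<epsilon> / 4 * \<mu>\<close> edges.\<close>

lemma tail_le_cluster:
  assumes "0 < \<epsilon>" "0 < \<mu>" "k * l \<le> L" "L \<le> np" "k * \<nu> * L / np \<le> \<epsilon> / 4 * \<mu>"
  shows "avg p V (\<lambda>S. of_bool ((1 + \<epsilon>) * \<mu> \<le> e S))
    \<le> ((1 + \<epsilon> / 2) / (1 + \<epsilon>)) ^ l + avg p V (\<lambda>S. of_bool (cluster L (\<epsilon> / 4 * \<mu>) {} S))"
proof -
  let ?\<theta> = "(1 + \<epsilon> / 2) * \<mu>"
  have "avg p V (\<lambda>S. of_bool ((1 + \<epsilon>) * \<mu> \<le> e S))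
    \<le> avg p V (\<lambda>S. of_bool ((1 + \<epsilon>) * \<mu> \<le> e S \<and> no_seed L ?\<theta> S)
        + of_bool (cluster L (\<epsilon> / 4 * \<mu>) {} S))"
  proof (intro avg_mono)
    fix S assume S: "S \<subseteq> V"
    have "cluster L (\<epsilon> / 4 * \<mu>) {} S" if seed: "\<not> no_seed L ?\<theta> S"
    proof -
      obtain U where U: "U \<subseteq> S" "card U \<le> L" "?\<theta> < cond_mean U"
        using seed by (auto simp: no_seed_def not_le)
      then have "?\<theta> < \<mu> + \<epsilon> / 4 * \<mu> + e U"
        using cond_mean_le[OF order_trans[OF U(1) S] U(2) assms(4)] assms(5) by linarith
      then show ?thesis using U unfolding cluster_def by (intro exI[of _ U]) (auto simp: algebra_simps)
    qed
    then show "(of_bool ((1 + \<epsilon>) * \<mu> \<le> e S) :: real) \<le> of_bool ((1 + \<epsilon>) * \<mu> \<le> e S \<and> no_seed L ?\<theta> S)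
        + of_bool (cluster L (\<epsilon> / 4 * \<mu>) {} S)" by auto
  qed (use p_pos p_le_1 in auto)
  also have "\<dots> = avg p V (\<lambda>S. of_bool ((1 + \<epsilon>) * \<mu> \<le> e S \<and> no_seed L ?\<theta> S))
      + avg p V (\<lambda>S. of_bool (cluster L (\<epsilon> / 4 * \<mu>) {} S))" by (rule avg_add)
  also have "avg p V (\<lambda>S. of_bool ((1 + \<epsilon>) * \<mu> \<le> e S \<and> no_seed L ?\<theta> S))
      \<le> (?\<theta> / ((1 + \<epsilon>) * \<mu>)) ^ l"
    using tail_no_seed[of ?\<theta> "(1 + \<epsilon>) * \<mu>" l L] assms(1-3) by simp
  finally show ?thesis using assms by simp
qed

text \<open>Double counting of vertex degrees with Cauchy-Schwarz: the degrees sum to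
  \<open>k * e W\<close>, so the sum of their squares is large, and this sum counts pairs of edges
  with multiplicity at most \<open>k\<close>. As \<open>2 \<le> k\<close> and
  \<open>L \<le> e W\<close>, the diagonal pairs cannot account for it.\<close>

lemma card_intersecting_pairs:
  assumes "W \<subseteq> V" "card W \<le> L" "0 < L" "L \<le> real (e W)"
  shows "(e W)\<^sup>2 / L \<le> card {(A, B). A \<in> H \<and> B \<in> H \<and> A \<subseteq> W \<and> B \<subseteq> W \<and> A \<noteq> B \<and> A \<inter> B \<noteq> {}}"
    (is "_ \<le> real (card ?P)")
proof -
  define F where "F = {A \<in> H. A \<subseteq> W}"
  define f where "f = real (card F)"
  have f: "f = e W" by (simp add: f_def F_def e_def)
  have finF: "finite F" using finite_H by (simp add: F_def)
  have finW: "finite W" using assms finite_V finite_subset by blast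
  define deg where "deg v = (\<Sum>A\<in>F. of_bool (v \<in> A) :: real)" for v
  have card_eq: "(\<Sum>v\<in>W. of_bool (v \<in> B)) = real (card B)" if "B \<subseteq> W" for B
    using that finW by (simp add: inf_absorb2)
  have "(\<Sum>v\<in>W. deg v) = (\<Sum>A\<in>F. \<Sum>v\<in>W. of_bool (v \<in> A))"
    unfolding deg_def by (rule sum.swap)
  also have "\<dots> = (\<Sum>A\<in>F. real k)"
    by (intro sum.cong refl) (auto simp: F_def card_eq card_edge simp del: sum_of_bool_eq)
  finally have deg1: "(\<Sum>v\<in>W. deg v) = k * f" by (simp add: f_def)
  have "(\<Sum>v\<in>W. (deg v)\<^sup>2) = (\<Sum>v\<in>W. \<Sum>A\<in>F. \<Sum>B\<in>F. of_bool (v \<in> A \<inter> B))"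
    unfolding deg_def power2_eq_square sum_product by (intro sum.cong refl) auto
  also have "\<dots> = (\<Sum>A\<in>F. \<Sum>B\<in>F. \<Sum>v\<in>W. of_bool (v \<in> A \<inter> B))"
    by (subst sum.swap, intro sum.cong refl, subst sum.swap) auto
  also have "\<dots> = (\<Sum>A\<in>F. \<Sum>B\<in>F. real (card (A \<inter> B)))"
    by (intro sum.cong refl card_eq) (auto simp: F_def)
  also have "\<dots> \<le> (\<Sum>A\<in>F. \<Sum>B\<in>F. real k * (of_bool (A = B) + of_bool (A \<noteq> B \<and> A \<inter> B \<noteq> {})))"
  proof (intro sum_mono)
    fix A B assume "A \<in> F" "B \<in> F"
    then have "card (A \<inter> B) \<le> k"
      using card_edge finite_edge by (metis (no_types, lifting) F_def Int_lower1 card_mono mem_Collect_eq)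
    then show "real (card (A \<inter> B)) \<le> real k * (of_bool (A = B) + of_bool (A \<noteq> B \<and> A \<inter> B \<noteq> {}))"
      by (cases "A = B"; cases "A \<inter> B = {}") auto
  qed
  also have "\<dots> = k * (f + card ?P)"
  proof -
    have "(\<Sum>A\<in>F. \<Sum>B\<in>F. of_bool (A = B) :: real) = (\<Sum>A\<in>F. 1)"
      using finF by (intro sum.cong refl) (simp add: of_bool_def del: sum_of_bool_eq)
    moreover have "(\<Sum>A\<in>F. \<Sum>B\<in>F. of_bool (A \<noteq> B \<and> A \<inter> B \<noteq> {})) = real (card ?P)"
    proof -
      have "(\<Sum>A\<in>F. \<Sum>B\<in>F. of_bool (A \<noteq> B \<and> A \<inter> B \<noteq> {}))
          = (\<Sum>x\<in>F \<times> F. of_bool (fst x \<noteq> snd x \<and> fst x \<inter> snd x \<noteq> {}))"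
        by (simp add: sum.cartesian_product case_prod_unfold del: sum_of_bool_eq)
      also have "\<dots> = real (card {x \<in> F \<times> F. fst x \<noteq> snd x \<and> fst x \<inter> snd x \<noteq> {}})"
        using finF by (simp add: Int_def)
      also have "{x \<in> F \<times> F. fst x \<noteq> snd x \<and> fst x \<inter> snd x \<noteq> {}} = ?P" by (auto simp: F_def)
      finally show ?thesis .
    qed
    ultimately show ?thesis by (simp add: f_def sum.distrib flip: sum_distrib_left)
  qed
  finally have deg2: "(\<Sum>v\<in>W. (deg v)\<^sup>2) \<le> k * (f + card ?P)" .
  have "(k * f)\<^sup>2 \<le> (\<Sum>v\<in>W. (deg v)\<^sup>2) * card W"
    unfolding deg1[symmetric] by (rule sum_squared_le_sum_of_squares)
  also have "\<dots> \<le> (k * (f + card ?P)) * L"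
    using assms deg2 by (intro mult_mono) (auto simp: f_def)
  finally have "k * (k * f\<^sup>2) \<le> k * ((f + card ?P) * L)"
    by (simp add: power2_eq_square algebra_simps)
  then have *: "k * f\<^sup>2 \<le> (f + card ?P) * L" using k_ge_2 by simp
  have "2 * f\<^sup>2 \<le> k * f\<^sup>2" using k_ge_2 by (intro mult_right_mono) auto
  moreover have "f * L \<le> f\<^sup>2" using assms f unfolding power2_eq_square by (intro mult_left_mono) auto
  ultimately have "f\<^sup>2 \<le> card ?P * L" using * by (simp add: algebra_simps)
  then show ?thesis using assms f by (simp add: divide_le_eq)
qed

definition disjoint_pairs :: "'a set \<Rightarrow> ('a set \<times> 'a set) set" where
  "disjoint_pairs Z = {(A, B). A \<in> H \<and> B \<in> H \<and> A \<noteq> B \<and> A \<inter> B \<noteq> {} \<and> (A \<union> B) \<inter> Z = {}}"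

lemma finite_disjoint_pairs: "finite (disjoint_pairs Z)"
  by (rule finite_subset[of _ "H \<times> H"]) (auto simp: disjoint_pairs_def finite_H)

text \<open>Sum over the first edge \<open>A\<close>. The second edge touches \<open>A\<close>
  without lying in it, since all edges have \<open>k\<close> vertices, so
  \<open>touching_weight_le\<close> with \<open>A\<close> in the role of \<open>Z\<close> gives the
  last factor.\<close>

lemma disjoint_pairs_weight:
  assumes "k \<le> np"
  shows "(\<Sum>(A, B)\<in>disjoint_pairs Z. p ^ card (A \<union> B)) \<le> \<mu> * (k * \<nu> * k / np)"
proof -
  have "(\<Sum>(A, B)\<in>disjoint_pairs Z. p ^ card (A \<union> B))
      \<le> (\<Sum>(A, B)\<in>Sigma H touching. p ^ card (A \<union> B))"
  proof (rule sum_mono2)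
    show "finite (Sigma H touching)" using finite_H finite_touching by auto
    show "disjoint_pairs Z \<subseteq> Sigma H touching"
    proof clarify
      fix A B assume "(A, B) \<in> disjoint_pairs Z"
      then have AB: "A \<in> H" "B \<in> H" "A \<noteq> B" "A \<inter> B \<noteq> {}" by (auto simp: disjoint_pairs_def)
      then have "\<not> B \<subseteq> A" using card_edge finite_edge by (metis card_subset_eq)
      then show "A \<in> H \<and> B \<in> touching A" using AB by (auto simp: touching_def)
    qed
  qed (use p_pos in auto)
  also have "\<dots> = (\<Sum>A\<in>H. \<Sum>B\<in>touching A. p ^ card (A \<union> B))"
    using finite_H finite_touching by (subst sum.Sigma) auto
  also have "\<dots> = (\<Sum>A\<in>H. p ^ k * (\<Sum>B\<in>touching A. p ^ card (B - A)))"
    unfolding sum_distrib_left using finite_edge card_edge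
    by (intro sum.cong refl) (auto simp: power_card_Un touching_def)
  also have "\<dots> \<le> (\<Sum>A\<in>H. p ^ k * (k * \<nu> * k / np))"
    using assms p_pos edge_subset card_edge
    by (intro sum_mono mult_left_mono touching_weight_le) auto
  finally show ?thesis by (simp add: \<mu>_def)
qed

text \<open>A dense small set \<open>U \<supseteq> Z\<close> always allows many ways to enlarge \<open>Z\<close> inside \<open>U\<close> by a piece of
  atypically small expected number: if \<open>U - Z\<close> still spans half of the edges, its average degree is
  large and it contains many intersecting pairs of edges; otherwise many edges of \<open>U\<close> meet \<open>Z\<close>
  without lying in it.\<close>

lemma cluster_step:
  assumes Z: "Z \<subseteq> V" "K * card Z ^ (k - 1) \<le> E / 4"
    and E: "0 < L" "2 * L \<le> E"
    and S: "S \<subseteq> V"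
  shows "of_bool (cluster L E Z S) \<le> 4 / E * (\<Sum>B\<in>touching Z. of_bool (cluster L E (Z \<union> B) S))
    + 4 * L / E\<^sup>2 * (\<Sum>(A, B)\<in>disjoint_pairs Z. of_bool (cluster L E (Z \<union> (A \<union> B)) S))"
    (is "_ \<le> ?a * ?X + ?b * ?Y")
proof (cases "cluster L E Z S")
  case False
  have "0 \<le> ?X" "0 \<le> ?Y" by (auto intro!: sum_nonneg)
  then have "0 \<le> ?a * ?X" "0 \<le> ?b * ?Y" using E by (auto intro!: mult_nonneg_nonneg divide_nonneg_nonneg)
  then show ?thesis using False by simp
next
  case True
  then obtain U where U: "Z \<subseteq> U" "U \<subseteq> S" "card U \<le> L" "E \<le> e U" by (auto simp: cluster_def)
  have finU: "finite U" using U S finite_V by (meson finite_subset)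
  have X0: "0 \<le> ?X" and Y0: "0 \<le> ?Y" by (auto intro!: sum_nonneg)
  have Epos: "0 < E" using E by linarith
  have cl: "cluster L E (Z \<union> B) S" if "B \<subseteq> U" for B
    unfolding cluster_def using that U by (intro exI[of _ U]) auto
  show ?thesis
  \<comment> \<open>The first case offers at least \<open>E\<^sup>2 / (4 * L)\<close> pairs and the
    second at least \<open>E / 4\<close> edges; the two coefficients in the claim are the
    reciprocals of these numbers.\<close>
  proof (cases "E / 2 \<le> e (U - Z)")
    case True
    let ?P = "{(A, B). A \<in> H \<and> B \<in> H \<and> A \<subseteq> U - Z \<and> B \<subseteq> U - Z \<and> A \<noteq> B \<and> A \<inter> B \<noteq> {}}"
    have "card (U - Z) \<le> L" using U(3) card_mono[OF finU, of "U - Z"] by auto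
    then have "(e (U - Z))\<^sup>2 / L \<le> card ?P"
      using E U S True by (intro card_intersecting_pairs) auto
    moreover have "(E / 2)\<^sup>2 \<le> (e (U - Z))\<^sup>2" using True Epos
      unfolding of_nat_power by (intro power_mono) auto
    ultimately have "(E / 2)\<^sup>2 / L \<le> card ?P"
      by (meson divide_right_mono of_nat_0_le_iff order_trans)
    also have "card ?P \<le> ?Y"
    proof -
      have "cluster L E (Z \<union> (A \<union> B)) S" if "A \<subseteq> U - Z" "B \<subseteq> U - Z" for A B
        using that by (intro cl) auto
      then have "real (card ?P) = (\<Sum>(A, B)\<in>?P. of_bool (cluster L E (Z \<union> (A \<union> B)) S))"
        by (subst sum.cong[OF refl, of _ _ "\<lambda>_. 1"]) auto
      also have "\<dots> \<le> ?Y"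
        using finite_disjoint_pairs by (intro sum_mono2) (auto simp: disjoint_pairs_def)
      finally show ?thesis .
    qed
    finally have "?b * ((E / 2)\<^sup>2 / L) \<le> ?b * ?Y" by (intro mult_left_mono) auto
    moreover have "?b * ((E / 2)\<^sup>2 / L) = 1" using Epos E by (simp add: power2_eq_square)
    moreover have "0 \<le> ?a * ?X" using X0 Epos by simp
    moreover have "of_bool (cluster L E Z S) \<le> (1::real)" by simp
    ultimately show ?thesis by linarith
  next
    case False
    let ?T = "{B \<in> touching Z. B \<subseteq> U}"
    have "{A \<in> H. A \<subseteq> U} \<subseteq> {A \<in> H. A \<subseteq> U - Z} \<union> {A \<in> H. A \<subseteq> Z} \<union> ?T"
      by (auto simp: touching_def)
    then have "e U \<le> card ({A \<in> H. A \<subseteq> U - Z} \<union> {A \<in> H. A \<subseteq> Z} \<union> ?T)"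
      unfolding e_def using finite_H finite_touching by (intro card_mono) auto
    also have "\<dots> \<le> e (U - Z) + e Z + card ?T"
      unfolding e_def by (meson add_mono card_Un_le le_refl order_trans)
    finally have "real (e U) \<le> e (U - Z) + e Z + card ?T" by linarith
    moreover have "real (e Z) \<le> E / 4"
      using e_le[OF Z(1)] Z(2) by (meson of_nat_le_iff order_trans)
    ultimately have "E / 4 \<le> card ?T" using False U by linarith
    also have "card ?T \<le> ?X"
    proof -
      have "real (card ?T) = (\<Sum>B\<in>?T. of_bool (cluster L E (Z \<union> B) S))"
        using cl by (subst sum.cong[OF refl, of _ _ "\<lambda>_. 1"]) auto
      also have "\<dots> \<le> ?X" using finite_touching by (intro sum_mono2) auto
      finally show ?thesis .
    qed
    finally have "?a * (E / 4) \<le> ?a * ?X" using Epos by (intro mult_left_mono) auto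
    moreover have "?a * (E / 4) = 1" using Epos by simp
    moreover have "0 \<le> ?b * ?Y" using Y0 by (intro mult_nonneg_nonneg) auto
    moreover have "of_bool (cluster L E Z S) \<le> (1::real)" by simp
    ultimately show ?thesis by linarith
  qed
qed

text \<open>Induction on the number \<open>t\<close> of exploration steps. By
  \<open>cluster_step\<close> the indicator is at most a weighted sum over enlargements of
  \<open>Z\<close>; each enlargement costs a factor \<open>p\<close> per new vertex, and the total
  weight of one step is at most \<open>\<rho>\<close>. A step adds at most \<open>2 * k\<close>
  vertices, so the explored part stays within size \<open>z\<close>.\<close>

lemma prob_cluster:
  assumes E: "0 < L" "2 * L \<le> E" and z: "K * z ^ (k - 1) \<le> E / 4" "z \<le> np" "k \<le> np"
    and \<rho>: "4 / E * (k * \<nu> * z / np) + 4 * L / E\<^sup>2 * (\<mu> * (k * \<nu> * k / np)) \<le> \<rho>"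
    and "Z \<subseteq> V" "card Z + 2 * k * t \<le> z"
  shows "avg p V (\<lambda>S. of_bool (cluster L E Z S)) \<le> p ^ card Z * \<rho> ^ t"
  using assms(7,8)
proof (induction t arbitrary: Z)
  case 0
  have "avg p V (\<lambda>S. of_bool (cluster L E Z S)) \<le> avg p V (\<lambda>S. of_bool (Z \<subseteq> S))"
    using p_pos p_le_1 by (intro avg_mono) (auto simp: cluster_def)
  then show ?case using 0 finite_V by (simp add: avg_superset)
next
  case (Suc t)
  have finZ: "finite Z" using Suc.prems finite_V finite_subset by blast
  have Epos: "0 < E" using E by linarith
  have \<rho>0: "0 \<le> \<rho>"
    by (rule order_trans[OF _ \<rho>]) (use Epos \<nu>_nonneg \<mu>_nonneg np_nonneg in \<open>auto intro!: add_nonneg_nonneg\<close>)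
  have cZ: "card Z \<le> z" using Suc.prems by simp
  have cZ': "K * card Z ^ (k - 1) \<le> E / 4"
  proof -
    have "K * card Z ^ (k - 1) \<le> K * z ^ (k - 1)" using cZ by (intro mult_left_mono power_mono) auto
    then show ?thesis using z(1) by (meson of_nat_le_iff order_trans)
  qed
  have "avg p V (\<lambda>S. of_bool (cluster L E Z S))
    \<le> avg p V (\<lambda>S. 4 / E * (\<Sum>B\<in>touching Z. of_bool (cluster L E (Z \<union> B) S))
      + 4 * L / E\<^sup>2 * (\<Sum>x\<in>disjoint_pairs Z. of_bool (cluster L E (Z \<union> (fst x \<union> snd x)) S)))"
    using cluster_step[OF Suc.prems(1) cZ' E] p_pos p_le_1
    by (intro avg_mono) (auto simp: case_prod_unfold)
  also have "\<dots> = 4 / E * (\<Sum>B\<in>touching Z. avg p V (\<lambda>S. of_bool (cluster L E (Z \<union> B) S)))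
      + 4 * L / E\<^sup>2 * (\<Sum>x\<in>disjoint_pairs Z. avg p V (\<lambda>S. of_bool (cluster L E (Z \<union> (fst x \<union> snd x)) S)))"
    by (simp only: avg_add avg_cmult avg_sum)
  also have "\<dots> \<le> 4 / E * (\<Sum>B\<in>touching Z. p ^ card (Z \<union> B) * \<rho> ^ t)
      + 4 * L / E\<^sup>2 * (\<Sum>x\<in>disjoint_pairs Z. p ^ card (Z \<union> (fst x \<union> snd x)) * \<rho> ^ t)"
  proof (intro add_mono mult_left_mono sum_mono Suc.IH)
    fix B assume B: "B \<in> touching Z"
    then have "B \<in> H" by (simp add: touching_def)
    then show "Z \<union> B \<subseteq> V" "card (Z \<union> B) + 2 * k * t \<le> z"
      using edge_subset card_edge[of B] Suc.prems card_Un_le[of Z B] by auto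
  next
    fix x assume "x \<in> disjoint_pairs Z"
    then have "fst x \<in> H" "snd x \<in> H" by (auto simp: disjoint_pairs_def)
    then show "Z \<union> (fst x \<union> snd x) \<subseteq> V" "card (Z \<union> (fst x \<union> snd x)) + 2 * k * t \<le> z"
      using edge_subset card_edge[of "fst x"] card_edge[of "snd x"] Suc.prems
        card_Un_le[of Z "fst x \<union> snd x"] card_Un_le[of "fst x" "snd x"] by auto
  qed (use Epos in auto)
  also have "(\<Sum>B\<in>touching Z. p ^ card (Z \<union> B) * \<rho> ^ t)
      = p ^ card Z * \<rho> ^ t * (\<Sum>B\<in>touching Z. p ^ card (B - Z))"
    unfolding sum_distrib_left
    by (intro sum.cong refl) (auto simp: touching_def power_card_Un finZ finite_edge)
  also have "(\<Sum>x\<in>disjoint_pairs Z. p ^ card (Z \<union> (fst x \<union> snd x)) * \<rho> ^ t)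
      = p ^ card Z * \<rho> ^ t * (\<Sum>(A, B)\<in>disjoint_pairs Z. p ^ card (A \<union> B))"
    unfolding sum_distrib_left case_prod_unfold
  proof (intro sum.cong refl)
    fix x assume "x \<in> disjoint_pairs Z"
    then have "finite (fst x \<union> snd x)" "(fst x \<union> snd x) - Z = fst x \<union> snd x"
      using finite_edge by (auto simp: disjoint_pairs_def)
    then show "p ^ card (Z \<union> (fst x \<union> snd x)) * \<rho> ^ t
        = p ^ card Z * \<rho> ^ t * p ^ card (fst x \<union> snd x)"
      using power_card_Un[OF finZ, of "fst x \<union> snd x"] by simp
  qed
  also have "4 / E * (p ^ card Z * \<rho> ^ t * (\<Sum>B\<in>touching Z. p ^ card (B - Z)))
      + 4 * L / E\<^sup>2 * (p ^ card Z * \<rho> ^ t * (\<Sum>(A, B)\<in>disjoint_pairs Z. p ^ card (A \<union> B)))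
    = p ^ card Z * \<rho> ^ t * (4 / E * (\<Sum>B\<in>touching Z. p ^ card (B - Z))
      + 4 * L / E\<^sup>2 * (\<Sum>(A, B)\<in>disjoint_pairs Z. p ^ card (A \<union> B)))"
    by (simp add: algebra_simps)
  also have "\<dots> \<le> p ^ card Z * \<rho> ^ t * (4 / E * (k * \<nu> * z / np) + 4 * L / E\<^sup>2 * (\<mu> * (k * \<nu> * k / np)))"
    using cZ z Suc.prems Epos p_pos \<rho>0
    by (intro mult_left_mono add_mono touching_weight_le disjoint_pairs_weight) auto
  also have "\<dots> \<le> p ^ card Z * \<rho> ^ t * \<rho>"
    using \<rho> p_pos \<rho>0 by (intro mult_left_mono) auto
  finally show ?case by (simp add: algebra_simps)
qed

section \<open>Choice of parameters for the upper tail\<close>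

lemma \<nu>_eq: "\<nu> = K * np ^ (k - 1) * p"
proof -
  have "p ^ k = p ^ (k - 1) * p" using k_ge_2 by (metis Suc_diff_1 less_le_trans pos2 power_Suc2)
  then show ?thesis by (simp add: \<nu>_def np_def power_mult_distrib)
qed

text \<open>The first term comes from a moment of order about \<open>c1 * \<Phi>\<close>, the second
  from exploring a cluster for a number of steps of order \<open>m\<close>, each gaining a factor
  \<open>p powr (\<gamma> / 2)\<close>. The conditions on \<open>c1\<close> and \<open>c2\<close>
  secure the hypotheses of \<open>tail_le_cluster\<close> and \<open>prob_cluster\<close>.\<close>

lemma upper_tail_sum:
  fixes \<epsilon> B c1 c2 :: real
  defines "\<gamma> \<equiv> 1 / real (k - 1)" and "\<eta> \<equiv> (1 + \<epsilon> / 2) / (1 + \<epsilon>)"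
  defines "m \<equiv> \<mu> powr \<gamma>"
  defines "\<Phi> \<equiv> min \<mu> (m * ln (1 / p))"
  assumes eps: "0 < \<epsilon>" and mu: "0 < \<mu>" and nu: "\<nu> \<le> B * \<mu>" and knp: "k \<le> np"
    and c1: "0 < c1" "2 * k\<^sup>2 * K * c1 \<le> 1" "8 * k ^ 3 * B * K * c1 \<le> \<epsilon>" "8 * k * c1 \<le> \<epsilon>"
      "256 * k ^ 4 * B * K * c1 \<le> \<epsilon>\<^sup>2"
    and c2: "0 < c2" "c2 \<le> 1" "16 * K * c2 \<le> \<epsilon>" "K * c2 \<le> 1" "32 * k * B * K * c2 \<le> \<epsilon>"
    and large: "4 * k \<le> c2 * m"
  shows "avg p V (\<lambda>S. of_bool ((1 + \<epsilon>) * \<mu> \<le> e S))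
    \<le> 1 / \<eta> * \<eta> powr (c1 * \<Phi>) + exp (- (\<gamma> * c2 / (8 * k)) * \<Phi>)"
proof -
  define h where "h = ln (1 / p)"
  define x where "x = p powr (\<gamma> / 2)"
  have \<gamma>: "0 < \<gamma>" "\<gamma> \<le> 1" using k_ge_2 by (auto simp: \<gamma>_def)
  have h: "0 \<le> h" using p_pos p_le_1 by (simp add: h_def)
  have x: "0 < x" "x \<le> 1" and xx: "x * x = p powr \<gamma>"
    using p_pos p_le_1 \<gamma> by (auto simp: x_def powr_le1 simp flip: powr_add)
  have np: "0 < np" using knp k_ge_2 by linarith
  have m: "0 < m" using mu by (simp add: m_def)
  have \<eta>: "0 < \<eta>" "\<eta> < 1" using eps by (auto simp: \<eta>_def field_simps)
  have \<Phi>: "0 \<le> \<Phi>" "\<Phi> \<le> \<mu>" "\<Phi> \<le> m * h" using mu m h by (auto simp: \<Phi>_def h_def)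
  have K1: "1 \<le> K"
  proof (rule ccontr)
    assume "\<not> 1 \<le> K"
    then have "\<nu> = 0" unfolding \<nu>_def by simp
    then show False using mu \<mu>_le_\<nu> by simp
  qed
  have B1: "1 \<le> B"
  proof -
    have "1 * \<mu> \<le> B * \<mu>" using nu \<mu>_le_\<nu> by linarith
    then show ?thesis using mu by simp
  qed
  \<comment> \<open>This lets one of the two factors \<open>x\<close> of
    \<open>p powr \<gamma>\<close> absorb the logarithm \<open>h\<close>; the price is that a step
    gains only \<open>p powr (\<gamma> / 2)\<close>.\<close>
  have ln_x: "x * h \<le> 2 * k"
  proof -
    have "ln (1 / x) \<le> 1 / x - 1" using x by (intro ln_le_minus_one) auto
    moreover have "ln (1 / x) = \<gamma> / 2 * h" using p_pos by (simp add: x_def h_def ln_div ln_powr)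
    ultimately have "\<gamma> / 2 * h * x \<le> (1 / x) * x" using x by (intro mult_right_mono) auto
    then have "h * x \<le> 2 / \<gamma>" using x \<gamma> by (simp add: field_simps)
    also have "\<dots> \<le> 2 * k" by (simp add: \<gamma>_def)
    finally show ?thesis by (simp add: mult.commute)
  qed
  \<comment> \<open>Take the \<open>(k - 1)\<close>-th root in
    \<open>\<mu> \<le> \<nu> = K * np ^ (k - 1) * p\<close>.\<close>
  have m_le: "m \<le> K * np * (x * x)"
  proof -
    have "m \<le> \<nu> powr \<gamma>" unfolding m_def using mu \<gamma> \<mu>_le_\<nu> by (intro powr_mono2) auto
    also have "\<dots> = K powr \<gamma> * (np ^ (k - 1)) powr \<gamma> * p powr \<gamma>"
      using np p_pos unfolding \<nu>_eq by (simp add: powr_mult)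
    also have "(np ^ (k - 1)) powr \<gamma> = np"
      using np k_ge_2 by (simp add: \<gamma>_def powr_powr flip: powr_realpow)
    also have "K powr \<gamma> * np * p powr \<gamma> \<le> K * np * p powr \<gamma>"
    proof -
      have "real K powr \<gamma> \<le> real K powr 1" using K1 \<gamma> by (intro powr_mono) auto
      then show ?thesis using np K1 by (intro mult_right_mono) auto
    qed
    finally show ?thesis unfolding xx .
  qed
  \<comment> \<open>\<open>l\<close> is the order of the moment, and \<open>L\<close> bounds the
    number of vertices of \<open>l\<close> edges.\<close>
  define l where "l = nat \<lfloor>c1 * \<Phi>\<rfloor>"
  define L where "L = k * l"
  have l: "real l \<le> c1 * \<Phi>" "c1 * \<Phi> - 1 \<le> real l"
    using c1 \<Phi> unfolding l_def by (auto simp: le_floor_iff)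
  have L\<mu>: "real L \<le> k * c1 * \<mu>"
  proof -
    have "real l \<le> c1 * \<mu>" using l \<Phi> c1 by (meson mult_left_mono less_imp_le order_trans)
    then show ?thesis by (simp add: L_def mult_left_mono mult.assoc)
  qed
  have Lnp: "L / np \<le> 2 * k\<^sup>2 * K * c1 * x"
  proof -
    have "real l \<le> c1 * (m * h)" using l \<Phi> c1 by (meson mult_left_mono less_imp_le order_trans)
    also have "\<dots> \<le> c1 * (K * np * (x * x) * h)"
      using m_le h c1 by (intro mult_left_mono mult_right_mono) auto
    also have "\<dots> = c1 * K * np * x * (x * h)" by simp
    also have "\<dots> \<le> c1 * K * np * x * (2 * k)"
      using ln_x c1 x np by (intro mult_left_mono) auto
    finally have "k * real l \<le> k * (c1 * K * np * x * (2 * k))" by (intro mult_left_mono) auto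
    then show ?thesis using np by (simp add: L_def field_simps power2_eq_square)
  qed
  have Lnp': "L / np \<le> 2 * k\<^sup>2 * K * c1"
  proof -
    have "2 * k\<^sup>2 * K * c1 * x \<le> 2 * k\<^sup>2 * K * c1 * 1"
      using x(2) c1(1) by (intro mult_left_mono) auto
    then show ?thesis using Lnp by linarith
  qed
  have "L / np \<le> 1" using Lnp' c1(2) by linarith
  then have L_le: "L \<le> np" using np by simp
  \<comment> \<open>The size limit for the explored part, chosen so that this part spans at most a
    quarter of the edges that a cluster must have.\<close>
  define z where "z = nat \<lfloor>c2 * m\<rfloor>"
  have z: "real z \<le> c2 * m" "c2 * m - 1 < real z" 
  proof -
    have "real z = of_int \<lfloor>c2 * m\<rfloor>" unfolding z_def using c2 m by simp
    then show "real z \<le> c2 * m" "c2 * m - 1 < real z"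
      using of_int_floor_le[of "c2 * m"] real_of_int_floor_gt_diff_one[of "c2 * m"] by simp_all
  qed
  have znp: "z / np \<le> K * c2 * (x * x)"
  proof -
    have "real z \<le> c2 * (K * np * (x * x))"
      using z m_le c2 by (meson mult_left_mono less_imp_le order_trans)
    then show ?thesis using np by (simp add: field_simps)
  qed
  have "x * x \<le> 1" using x by (simp add: mult_le_one)
  then have "K * c2 * (x * x) \<le> 1 * 1" using c2 x by (intro mult_mono) auto
  then have "z / np \<le> 1" using znp by linarith
  then have z_le: "z \<le> np" using np by simp
  have zK: "K * z ^ (k - 1) \<le> \<epsilon> / 4 * \<mu> / 4"
  proof -
    have "real z ^ (k - 1) \<le> (c2 * m) ^ (k - 1)" using z by (intro power_mono) auto
    also have "\<dots> = c2 ^ (k - 1) * \<mu>"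
      using mu k_ge_2 by (simp add: m_def \<gamma>_def power_mult_distrib powr_powr flip: powr_realpow)
    also have "\<dots> \<le> c2 ^ 1 * \<mu>"
      using c2 mu k_ge_2 by (intro mult_right_mono power_decreasing) auto
    finally have "K * real z ^ (k - 1) \<le> K * (c2 * \<mu>)" by (intro mult_left_mono) auto
    also have "\<dots> \<le> \<epsilon> / 16 * \<mu>" using c2(3) mu by simp
    finally show ?thesis by simp
  qed
  define t where "t = z div (2 * k)"
  have t: "2 * k * t \<le> z" by (simp add: t_def)
  \<comment> \<open>The hypothesis \<open>4 * k \<le> c2 * m\<close> absorbs the two roundings in
    \<open>z\<close> and \<open>t\<close>.\<close>
  have t_ge: "c2 * m / (4 * k) \<le> t"
  proof -
    have "z < 2 * k * (t + 1)" unfolding t_def using k_ge_2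
      by (metis Suc_eq_plus1 dividend_less_times_div mult_pos_pos pos2 zero_less_numeral less_le_trans mult_Suc_right)
    then have "z + 1 \<le> 2 * k * (t + 1)" by simp
    then have "real (z + 1) \<le> real (2 * k * (t + 1))" by (simp only: of_nat_le_iff)
    then have "c2 * m \<le> 2 * k * t + 2 * k" using z by (simp add: algebra_simps)
    then have "c2 * m \<le> 4 * k * t" using large by linarith
    then show ?thesis using k_ge_2 by (simp add: field_simps)
  qed
  let ?E = "\<epsilon> / 4 * \<mu>"
  \<comment> \<open>Each kind of exploration step gets half of \<open>x\<close>. Touching edges gain
    \<open>x * x\<close> through \<open>z / np\<close>; intersecting pairs gain only
    \<open>x\<close>, because the bound on \<open>L\<close> contains the logarithm.\<close>
  have \<rho>: "4 / ?E * (k * \<nu> * z / np) + 4 * real L / ?E\<^sup>2 * (\<mu> * (k * \<nu> * k / np)) \<le> x"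
  proof -
    have "4 / ?E * (k * \<nu> * z / np) = 16 * k / (\<epsilon> * \<mu>) * (\<nu> * (z / np))"
      using eps mu by (simp add: field_simps)
    also have "\<dots> \<le> 16 * k / (\<epsilon> * \<mu>) * (B * \<mu> * (K * c2 * (x * x)))"
      using nu znp eps mu np B1 by (intro mult_left_mono mult_mono) auto
    also have "\<dots> = (32 * k * B * K * c2) * (x * x / (2 * \<epsilon>))" using eps mu by (simp add: field_simps)
    also have "\<dots> \<le> \<epsilon> * (x * x / (2 * \<epsilon>))" using c2 eps by (intro mult_right_mono) auto
    also have "\<dots> = x * x / 2" using eps by simp
    also have "\<dots> \<le> x / 2" using x by (simp add: mult_left_le)
    finally have a: "4 / ?E * (k * \<nu> * z / np) \<le> x / 2" .
    have "4 * real L / ?E\<^sup>2 * (\<mu> * (k * \<nu> * k / np)) = 64 * k\<^sup>2 / (\<epsilon>\<^sup>2 * \<mu>) * (\<nu> * (L / np))"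
      using eps mu by (simp add: field_simps power2_eq_square)
    also have "\<dots> \<le> 64 * k\<^sup>2 / (\<epsilon>\<^sup>2 * \<mu>) * (B * \<mu> * (2 * k\<^sup>2 * K * c1 * x))"
      using nu Lnp eps mu np B1 by (intro mult_left_mono mult_mono) auto
    also have "\<dots> = (256 * k ^ 4 * B * K * c1) * (x / (2 * \<epsilon>\<^sup>2))"
      using eps mu by (simp add: field_simps power2_eq_square power4_eq_xxxx)
    also have "\<dots> \<le> \<epsilon>\<^sup>2 * (x / (2 * \<epsilon>\<^sup>2))" using c1(5) eps x by (intro mult_right_mono) auto
    also have "\<dots> = x / 2" using eps by simp
    finally show ?thesis using a by linarith
  qed
  show ?thesis
  proof (cases "l = 0")
    \<comment> \<open>Now \<open>c1 * \<Phi> \<le> 1\<close>, and the prefactor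
      \<open>1 / \<eta>\<close> makes the first term at least \<open>1\<close>.\<close>
    case True
    have "avg p V (\<lambda>S. of_bool ((1 + \<epsilon>) * \<mu> \<le> e S)) \<le> avg p V (\<lambda>S. 1)"
      using p_pos p_le_1 by (intro avg_mono) auto
    also have "\<dots> = 1" using finite_V by (rule avg_const)
    also have "\<dots> \<le> 1 / \<eta> * \<eta> powr (c1 * \<Phi>)"
    proof -
      have "\<eta> powr 1 \<le> \<eta> powr (c1 * \<Phi>)" using l True \<eta> by (intro powr_mono') auto
      then show ?thesis using \<eta> by (simp add: field_simps)
    qed
    finally show ?thesis by (smt (verit) exp_gt_zero)
  next
    case False
    have L0: "0 < L" using False k_ge_2 by (simp add: L_def)
    have L2: "2 * L \<le> ?E"
    proof -
      have "2 * (k * c1 * \<mu>) = (8 * k * c1) * (\<mu> / 4)" by simp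
      also have "\<dots> \<le> \<epsilon> * (\<mu> / 4)" using c1(4) mu by (intro mult_right_mono) auto
      finally show ?thesis using L\<mu> by simp
    qed
    have "k * \<nu> * L / np \<le> ?E"
    proof -
      have "k * \<nu> * L / np = k * (\<nu> * (L / np))" by simp
      also have "\<dots> \<le> k * (B * \<mu> * (2 * k\<^sup>2 * K * c1))"
        using nu Lnp' mu np B1 by (intro mult_left_mono mult_mono) auto
      also have "\<dots> = (8 * k ^ 3 * B * K * c1) * (\<mu> / 4)"
        by (simp add: power2_eq_square power3_eq_cube)
      also have "\<dots> \<le> \<epsilon> * (\<mu> / 4)" using c1(3) mu by (intro mult_right_mono) auto
      finally show ?thesis by simp
    qed
    then have "avg p V (\<lambda>S. of_bool ((1 + \<epsilon>) * \<mu> \<le> e S))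
        \<le> \<eta> ^ l + avg p V (\<lambda>S. of_bool (cluster L ?E {} S))"
      unfolding \<eta>_def using eps mu L_le by (intro tail_le_cluster) (simp_all add: L_def)
    moreover have "avg p V (\<lambda>S. of_bool (cluster L ?E {} S)) \<le> p ^ card ({} :: 'a set) * x ^ t"
      using t by (intro prob_cluster[OF L0 L2 zK z_le knp \<rho>]) simp_all
    moreover have "\<eta> ^ l \<le> 1 / \<eta> * \<eta> powr (c1 * \<Phi>)"
    proof -
      have "\<eta> ^ l = \<eta> powr l" using \<eta> by (simp add: powr_realpow)
      also have "\<dots> \<le> \<eta> powr (c1 * \<Phi> - 1)" using l \<eta> by (intro powr_mono') auto
      finally show ?thesis using \<eta> by (simp add: powr_diff)
    qed
    moreover have "x ^ t \<le> exp (- (\<gamma> * c2 / (8 * k)) * \<Phi>)"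
    proof -
      have "x ^ t = exp (- (\<gamma> / 2 * h * t))"
        using p_pos by (simp add: x_def powr_def h_def ln_div mult_ac flip: exp_of_nat_mult)
      moreover have "\<gamma> * c2 / (8 * k) * \<Phi> \<le> \<gamma> / 2 * h * t"
      proof -
        have "\<gamma> * c2 / (8 * k) * \<Phi> \<le> \<gamma> * c2 / (8 * k) * (m * h)"
          using \<Phi> \<gamma> c2 by (intro mult_left_mono) auto
        also have "\<dots> = \<gamma> / 2 * h * (c2 * m / (4 * k))" by simp
        also have "\<dots> \<le> \<gamma> / 2 * h * t" using t_ge \<gamma> h by (intro mult_left_mono) auto
        finally show ?thesis .
      qed
      ultimately show ?thesis by simp
    qed
    ultimately show ?thesis by simp
  qed
qed

text \<open>A fixed bound below \<open>1\<close>, for the range where the exponential estimates lose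
  to their constants.\<close>

lemma Markov_upper_tail:
  assumes "0 < \<epsilon>" "0 < \<mu>"
  shows "avg p V (\<lambda>S. of_bool ((1 + \<epsilon>) * \<mu> \<le> e S)) \<le> 1 / (1 + \<epsilon>)"
proof -
  have "avg p V (\<lambda>S. of_bool ((1 + \<epsilon>) * \<mu> \<le> e S)) \<le> avg p V (\<lambda>S. 1 / ((1 + \<epsilon>) * \<mu>) * real (e S))"
  proof (intro avg_mono)
    fix S
    have "0 < (1 + \<epsilon>) * \<mu>" using assms by simp
    then show "of_bool ((1 + \<epsilon>) * \<mu> \<le> e S) \<le> 1 / ((1 + \<epsilon>) * \<mu>) * real (e S)"
      by (cases "(1 + \<epsilon>) * \<mu> \<le> e S") (simp_all add: le_divide_eq_1_pos)
  qed (use p_pos p_le_1 in auto)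
  also have "\<dots> = 1 / ((1 + \<epsilon>) * \<mu>) * \<mu>" by (simp only: avg_cmult avg_e)
  finally show ?thesis using assms by simp
qed

subsection \<open>The Poisson lower bound\<close>

text \<open>Second moment method: two edges of \<open>F\<close> are disjoint, equal, or distinct and
  intersecting, and these cases give the terms \<open>m\<^sup>2\<close>, \<open>m\<close> and
  \<open>D\<close> of the second moment.\<close>

lemma prob_contains_edge:
  assumes F: "F \<subseteq> H" and knp: "k \<le> np" and D: "\<mu> * (k * \<nu> * k / np) \<le> D"
    and m: "m = card F * p ^ k" and Q: "m\<^sup>2 + m + D \<le> Q" "0 < Q"
  shows "m\<^sup>2 / Q \<le> avg p V (\<lambda>S. of_bool (\<exists>A\<in>F. A \<subseteq> S))"
proof -
  have finF: "finite F" using F finite_H finite_subset by blast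
  have F_edge: "A \<subseteq> V" "card A = k" "finite A" if "A \<in> F" for A
    using that F edge_subset card_edge finite_edge by auto
  define X where "X S = (\<Sum>A\<in>F. of_bool (A \<subseteq> S) :: real)" for S
  have EX: "avg p V X = m"
  proof -
    have "avg p V X = (\<Sum>A\<in>F. avg p V (\<lambda>S. of_bool (A \<subseteq> S)))"
      unfolding X_def by (rule avg_sum)
    also have "\<dots> = (\<Sum>A\<in>F. p ^ k)"
      using F_edge finite_V by (intro sum.cong refl) (auto simp: avg_superset)
    finally show ?thesis by (simp add: m)
  qed
  have EX2: "avg p V (\<lambda>S. (X S)\<^sup>2) \<le> Q"
  proof -
    have "avg p V (\<lambda>S. (X S)\<^sup>2) = avg p V (\<lambda>S. \<Sum>x\<in>F \<times> F. of_bool (fst x \<union> snd x \<subseteq> S))"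
      unfolding X_def power2_eq_square sum_product sum.cartesian_product case_prod_unfold
      by (intro avg_cong sum.cong refl) auto
    also have "\<dots> = (\<Sum>x\<in>F \<times> F. p ^ card (fst x \<union> snd x))"
    proof -
      have "fst x \<union> snd x \<subseteq> V" if "x \<in> F \<times> F" for x
        using that F_edge(1)[of "fst x"] F_edge(1)[of "snd x"] by auto
      then show ?thesis unfolding avg_sum by (intro sum.cong refl avg_superset finite_V) blast
    qed
    also have "\<dots> \<le> (\<Sum>x\<in>F \<times> F. p ^ k * p ^ k + of_bool (fst x = snd x) * p ^ k
        + of_bool (x \<in> disjoint_pairs {}) * p ^ card (fst x \<union> snd x))"
    proof (intro sum_mono)
      fix x assume "x \<in> F \<times> F"
      then obtain A B where x: "x = (A, B)" "A \<in> F" "B \<in> F" by auto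
      then have *: "p ^ card (A \<union> B) = p ^ k * p ^ card (B - A)"
        using power_card_Un F_edge by metis
      show "p ^ card (fst x \<union> snd x) \<le> p ^ k * p ^ k + of_bool (fst x = snd x) * p ^ k
        + of_bool (x \<in> disjoint_pairs {}) * p ^ card (fst x \<union> snd x)"
      proof (cases "A = B \<or> A \<inter> B = {}")
        case True
        then show ?thesis using x F_edge p_pos * by (auto simp: Diff_triv Int_commute)
      next
        case False
        then have "x \<in> disjoint_pairs {}" using x F by (auto simp: disjoint_pairs_def)
        then show ?thesis using p_pos by (auto intro!: add_nonneg_nonneg)
      qed
    qed
    also have "\<dots> = (\<Sum>x\<in>F \<times> F. p ^ k * p ^ k) + (\<Sum>x\<in>F \<times> F. of_bool (fst x = snd x) * p ^ k)
        + (\<Sum>x\<in>F \<times> F. of_bool (x \<in> disjoint_pairs {}) * p ^ card (fst x \<union> snd x))"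
      by (simp only: sum.distrib)
    also have "(\<Sum>x\<in>F \<times> F. p ^ k * p ^ k) = m\<^sup>2"
      by (simp add: m power2_eq_square card_cartesian_product)
    also have "(\<Sum>x\<in>F \<times> F. of_bool (fst x = snd x) * p ^ k) = m"
    proof -
      have "(\<Sum>x\<in>F \<times> F. of_bool (fst x = snd x) * p ^ k) = (\<Sum>A\<in>F. \<Sum>B\<in>F. of_bool (A = B) * p ^ k)"
        by (simp add: sum.cartesian_product case_prod_unfold)
      also have "\<dots> = (\<Sum>A\<in>F. p ^ k)"
        using finF by (intro sum.cong refl) (simp add: of_bool_def if_distrib[of "\<lambda>a. a * _"] cong: if_cong)
      finally show ?thesis by (simp add: m)
    qed
    also have "(\<Sum>x\<in>F \<times> F. of_bool (x \<in> disjoint_pairs {}) * p ^ card (fst x \<union> snd x)) \<le> D"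
    proof -
      have "(\<Sum>x\<in>F \<times> F. of_bool (x \<in> disjoint_pairs {}) * p ^ card (fst x \<union> snd x))
          = (\<Sum>x\<in>(F \<times> F) \<inter> disjoint_pairs {}. p ^ card (fst x \<union> snd x))"
        using finF by (simp add: of_bool_def if_distrib[of "\<lambda>a. a * _"] sum.inter_restrict cong: if_cong)
      also have "\<dots> \<le> (\<Sum>x\<in>disjoint_pairs {}. p ^ card (fst x \<union> snd x))"
        using finite_disjoint_pairs p_pos by (intro sum_mono2) auto
      also have "\<dots> \<le> D"
        using disjoint_pairs_weight[OF knp, of "{}"] D by (simp add: case_prod_unfold)
      finally show ?thesis .
    qed
    finally show ?thesis using Q by linarith
  qed
  \<comment> \<open>In place of Cauchy-Schwarz, \<open>2 * a * X - a\<^sup>2 * X\<^sup>2\<close> is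
    pointwise at most the indicator of \<open>X \<noteq> 0\<close>; the choice
    \<open>a = m / Q\<close> is optimal.\<close>
  have "m\<^sup>2 / Q \<le> 2 * (m / Q) * m - (m / Q)\<^sup>2 * avg p V (\<lambda>S. (X S)\<^sup>2)"
  proof -
    have "(m / Q)\<^sup>2 * avg p V (\<lambda>S. (X S)\<^sup>2) \<le> (m / Q)\<^sup>2 * Q"
      using EX2 by (intro mult_left_mono) auto
    also have "\<dots> = m\<^sup>2 / Q" using Q by (simp add: power2_eq_square)
    finally show ?thesis by (simp add: power2_eq_square)
  qed
  also have "\<dots> = avg p V (\<lambda>S. 2 * (m / Q) * X S + - (m / Q)\<^sup>2 * (X S)\<^sup>2)"
    by (simp only: avg_add avg_cmult EX)
  also have "\<dots> \<le> avg p V (\<lambda>S. of_bool (\<exists>A\<in>F. A \<subseteq> S))"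
  proof (intro avg_mono)
    fix S
    show "2 * (m / Q) * X S + - (m / Q)\<^sup>2 * (X S)\<^sup>2 \<le> of_bool (\<exists>A\<in>F. A \<subseteq> S)"
    proof (cases "\<exists>A\<in>F. A \<subseteq> S")
      case True
      have "0 \<le> (1 - m / Q * X S)\<^sup>2" by simp
      also have "\<dots> = 1 - (2 * (m / Q) * X S + - (m / Q)\<^sup>2 * (X S)\<^sup>2)"
        by (simp add: power2_eq_square algebra_simps)
      finally show ?thesis using True by simp
    next
      case False
      then have "X S = 0" unfolding X_def by (intro sum.neutral) auto
      then show ?thesis by simp
    qed
  qed (use p_pos p_le_1 in auto)
  finally show ?thesis .
qed

text \<open>Form \<open>M\<close> disjoint classes of \<open>q\<close> edges each, \<open>M\<close>
  being \<open>(1 + \<epsilon>) * \<mu>\<close> rounded up. The expected number of edges from one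
  class lies between \<open>1 / (4 * (1 + \<epsilon>))\<close> and \<open>1\<close>, so each class
  contributes an edge with probability at least \<open>c\<close>. These events are increasing, so
  Harris' inequality multiplies the bounds, and together they yield \<open>M\<close> distinct
  edges.\<close>

lemma lower_tail_Poisson:
  fixes \<epsilon> D :: real
  defines "c \<equiv> 1 / (16 * (1 + \<epsilon>)\<^sup>2 * (2 + D))"
  assumes eps: "0 < \<epsilon>" and mu: "1 \<le> (1 + \<epsilon>) * \<mu>" "(1 + \<epsilon>) * \<mu> \<le> card H"
    and knp: "k \<le> np" and D: "\<mu> * (k * \<nu> * k / np) \<le> D"
  shows "c powr (2 * (1 + \<epsilon>) * \<mu>) \<le> avg p V (\<lambda>S. of_bool ((1 + \<epsilon>) * \<mu> \<le> e S))"
proof -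
  have D0: "0 \<le> D" using D \<mu>_nonneg \<nu>_nonneg np_nonneg by (smt (verit) divide_nonneg_nonneg mult_nonneg_nonneg of_nat_0_le_iff)
  define M where "M = nat \<lceil>(1 + \<epsilon>) * \<mu>\<rceil>"
  have M_ge: "(1 + \<epsilon>) * \<mu> \<le> M" unfolding M_def by linarith
  have M_le: "real M \<le> 2 * ((1 + \<epsilon>) * \<mu>)" using mu(1) unfolding M_def by linarith
  have M1: "1 \<le> M" using M_ge mu(1) by linarith
  have MH: "M \<le> card H" using mu(2) unfolding M_def by linarith
  define q where "q = card H div M"
  have q1: "1 \<le> q" unfolding q_def using MH M1 by (simp add: div_greater_zero_iff Suc_le_eq)
  have qM: "q * M \<le> card H" by (simp add: q_def)
  have qM': "card H \<le> 2 * (q * M)"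
  proof -
    have "card H < q * M + M" unfolding q_def using M1
      by (metis add.commute dividend_less_div_times less_le_trans zero_less_one)
    moreover have "M \<le> q * M" using q1 by simp
    ultimately show ?thesis by linarith
  qed
  obtain h where h: "bij_betw h {0..<card H} H" using ex_bij_betw_nat_finite[OF finite_H] by blast
  define F where "F i = h ` {i * q..<i * q + q}" for i
  have range: "{i * q..<i * q + q} \<subseteq> {0..<card H}" if "i < M" for i
  proof -
    have "i * q + q = Suc i * q" by simp
    also have "\<dots> \<le> M * q" using that by (intro mult_right_mono) auto
    finally show ?thesis using qM by (auto simp: mult.commute)
  qed
  have inj: "inj_on h {0..<card H}" using h by (simp add: bij_betw_def)
  have FH: "F i \<subseteq> H" if "i < M" for i
    using range[OF that] h unfolding F_def bij_betw_def by blast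
  have cardF: "card (F i) = q" if "i < M" for i
    unfolding F_def using inj_on_subset[OF inj range[OF that]] by (simp add: card_image)
  have disj: "i = j" if ij: "i < M" "j < M" "A \<in> F i" "A \<in> F j" for i j A
  proof -
    obtain a b where ab: "a \<in> {i * q..<i * q + q}" "b \<in> {j * q..<j * q + q}" "h a = A" "h b = A"
      using ij by (auto simp: F_def)
    then have "a = b" using range[OF ij(1)] range[OF ij(2)] inj unfolding inj_on_def by blast
    moreover have "a div q = i" "b div q = j"
      using ab q1 by (auto intro!: div_nat_eqI simp: mult.commute)
    ultimately show ?thesis by simp
  qed
  define m where "m = q * p ^ k"
  have m: "1 / (4 * (1 + \<epsilon>)) \<le> m" "m \<le> 1"
  proof -
    have "real (card H) \<le> real (2 * (q * M))" using qM' by (simp only: of_nat_le_iff)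
    then have "real (card H) * p ^ k \<le> real (2 * (q * M)) * p ^ k"
      using p_pos by (intro mult_right_mono) auto
    then have "\<mu> \<le> 2 * M * m" by (simp add: \<mu>_def m_def mult_ac)
    also have "\<dots> \<le> 2 * (2 * ((1 + \<epsilon>) * \<mu>)) * m"
      using M_le p_pos by (intro mult_right_mono mult_left_mono) (auto simp: m_def)
    finally have "\<mu> * 1 \<le> \<mu> * (4 * (1 + \<epsilon>) * m)" by (simp add: algebra_simps)
    moreover have "0 < \<mu>" using mu(1) eps by (smt (verit) mult_nonneg_nonpos)
    ultimately have "1 \<le> 4 * (1 + \<epsilon>) * m" by simp
    then show "1 / (4 * (1 + \<epsilon>)) \<le> m" using eps by (simp add: field_simps)
    have "real (q * M) * p ^ k \<le> \<mu>" unfolding \<mu>_def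
      using qM p_pos by (intro mult_right_mono) (auto simp del: of_nat_mult)
    then have "M * m \<le> \<mu>" by (simp add: m_def mult_ac)
    also have "\<dots> \<le> (1 + \<epsilon>) * \<mu>" using eps \<open>0 < \<mu>\<close> by (simp add: algebra_simps)
    also have "\<dots> \<le> M" by (rule M_ge)
    finally show "m \<le> 1" using M1 by (simp add: mult_le_cancel_left1)
  qed
  have c: "0 < c" "c \<le> 1"
  proof -
    have "1 * 1 \<le> (16 * (1 + \<epsilon>)\<^sup>2) * (2 + D)"
      using eps D0 by (intro mult_mono) (auto simp: power2_eq_square algebra_simps add_increasing)
    moreover have "0 < 1 / y \<and> 1 / y \<le> 1" if "1 \<le> y" for y :: real using that by simp
    ultimately show "0 < c" "c \<le> 1" unfolding c_def by (metis mult_1)+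
  qed
  have each: "c \<le> avg p V (\<lambda>S. of_bool (\<exists>A\<in>F i. A \<subseteq> S))" if "i < M" for i
  proof -
    have "c = (1 / (4 * (1 + \<epsilon>)))\<^sup>2 / (2 + D)"
      unfolding c_def power_divide power_mult_distrib by simp
    also have "\<dots> \<le> m\<^sup>2 / (2 + D)" using m eps D0 by (intro divide_right_mono power_mono) auto
    also have "\<dots> \<le> avg p V (\<lambda>S. of_bool (\<exists>A\<in>F i. A \<subseteq> S))"
    proof (rule prob_contains_edge[OF FH[OF that] knp D])
      show "m = card (F i) * p ^ k" using cardF[OF that] by (simp add: m_def)
      have "0 \<le> m" using p_pos by (simp add: m_def)
      then have "m\<^sup>2 \<le> 1" using m by (simp add: power_le_one)
      then show "m\<^sup>2 + m + D \<le> 2 + D" using m by linarith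
    qed (use D0 in auto)
    finally show ?thesis .
  qed
  have mono: "mono (\<lambda>S. of_bool (\<exists>A\<in>F i. A \<subseteq> S) :: real)" for i
  proof (rule monoI)
    fix S S' :: "'a set" assume "S \<subseteq> S'"
    then have "(\<exists>A\<in>F i. A \<subseteq> S) \<longrightarrow> (\<exists>A\<in>F i. A \<subseteq> S')" by blast
    then show "of_bool (\<exists>A\<in>F i. A \<subseteq> S) \<le> (of_bool (\<exists>A\<in>F i. A \<subseteq> S') :: real)"
      by (simp only: of_bool_less_eq_iff)
  qed
  have "c powr (2 * (1 + \<epsilon>) * \<mu>) \<le> c powr M" using M_le c by (intro powr_mono') (simp_all add: algebra_simps)
  also have "\<dots> = (\<Prod>i<M. c)" using c by (simp add: powr_realpow)
  also have "\<dots> \<le> (\<Prod>i<M. avg p V (\<lambda>S. of_bool (\<exists>A\<in>F i. A \<subseteq> S)))"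
    using each c by (intro prod_mono) auto
  also have "\<dots> \<le> avg p V (\<lambda>S. \<Prod>i<M. of_bool (\<exists>A\<in>F i. A \<subseteq> S))"
    using finite_V p_pos p_le_1 mono by (intro avg_Harris_prod) auto
  also have "\<dots> \<le> avg p V (\<lambda>S. of_bool ((1 + \<epsilon>) * \<mu> \<le> e S))"
  proof (intro avg_mono)
    fix S
    show "(\<Prod>i<M. of_bool (\<exists>A\<in>F i. A \<subseteq> S)) \<le> (of_bool ((1 + \<epsilon>) * \<mu> \<le> e S) :: real)"
    proof (cases "\<forall>i<M. \<exists>A\<in>F i. A \<subseteq> S")
      case True
      then obtain g where g: "\<And>i. i < M \<Longrightarrow> g i \<in> F i \<and> g i \<subseteq> S" by metis
      have "inj_on g {..<M}" using g disj by (intro inj_onI) (metis lessThan_iff)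
      moreover have "g ` {..<M} \<subseteq> {A \<in> H. A \<subseteq> S}" using g FH by blast
      ultimately have "M \<le> e S" unfolding e_def
        using finite_H card_inj_on_le[of g "{..<M}" "{A \<in> H. A \<subseteq> S}"] by simp
      then have "(1 + \<epsilon>) * \<mu> \<le> e S" using M_ge by linarith
      then show ?thesis by (simp add: prod_le_1)
    next
      case False
      then obtain i where i: "i < M" "\<not> (\<exists>A\<in>F i. A \<subseteq> S)" by blast
      have "(\<Prod>i<M. of_bool (\<exists>A\<in>F i. A \<subseteq> S)) = (0::real)"
        using i by (intro prod_zero bexI[of _ i]) auto
      also have "\<dots> \<le> of_bool ((1 + \<epsilon>) * \<mu> \<le> e S)" by simp
      finally show ?thesis .
    qed
  qed (use p_pos p_le_1 in auto)
  finally show ?thesis .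
qed

end

section \<open>The hypergraph of sums\<close>

text \<open>A set of \<open>r + s\<close> elements leaves no room for repetitions: \<open>x\<close>
  and \<open>y\<close> are injective with disjoint images, so sums over labels become sums over two
  sets.\<close>

lemma is_rs_sum_iff:
  "is_rs_sum r s A \<longleftrightarrow> (\<exists>P Q. A = P \<union> Q \<and> P \<inter> Q = {} \<and> finite P \<and> finite Q
    \<and> card P = r \<and> card Q = s \<and> \<Sum>P = \<Sum>Q)"
proof
  assume "is_rs_sum r s A"
  then obtain x y where A: "card A = r + s" "A = x ` {1..r} \<union> y ` {1..s}"
    and eq: "(\<Sum>i=1..r. x i) = (\<Sum>j=1..s. y j)"
    unfolding is_rs_sum_def by blast
  let ?P = "x ` {1..r}" and ?Q = "y ` {1..s}"
  have le: "card ?P \<le> r" "card ?Q \<le> s"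
    using card_image_le[of "{1..r}" x] card_image_le[of "{1..s}" y] by simp_all
  have "card ?P + card ?Q = card A + card (?P \<inter> ?Q)" unfolding A(2) by (intro card_Un_Int) auto
  then have c: "card ?P = r" "card ?Q = s" "card (?P \<inter> ?Q) = 0" using le A(1) by linarith+
  have "inj_on x {1..r}" "inj_on y {1..s}" using c by (auto intro!: eq_card_imp_inj_on)
  then have "\<Sum>?P = \<Sum>?Q" using eq by (simp add: sum.reindex)
  then show "\<exists>P Q. A = P \<union> Q \<and> P \<inter> Q = {} \<and> finite P \<and> finite Q
      \<and> card P = r \<and> card Q = s \<and> \<Sum>P = \<Sum>Q"
    using c A(2) by (intro exI[of _ ?P] exI[of _ ?Q]) auto
next
  assume "\<exists>P Q. A = P \<union> Q \<and> P \<inter> Q = {} \<and> finite P \<and> finite Q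
      \<and> card P = r \<and> card Q = s \<and> \<Sum>P = \<Sum>Q"
  then obtain P Q where PQ: "A = P \<union> Q" "P \<inter> Q = {}" "finite P" "finite Q" "card P = r" "card Q = s"
    "\<Sum>P = \<Sum>Q" by blast
  obtain x y where xy: "bij_betw x {1..r} P" "bij_betw y {1..s} Q"
    using ex_bij_betw_nat_finite_1 PQ by metis
  have "(\<Sum>i=1..r. x i) = \<Sum>P" "(\<Sum>j=1..s. y j) = \<Sum>Q"
    using sum.reindex_bij_betw[OF xy(1), of "\<lambda>z. z"] sum.reindex_bij_betw[OF xy(2), of "\<lambda>z. z"] by simp_all
  moreover have "card A = r + s" using PQ by (simp add: card_Un_disjoint)
  ultimately show "is_rs_sum r s A"
    unfolding is_rs_sum_def using PQ(1,7) bij_betw_imp_surj_on[OF xy(1)] bij_betw_imp_surj_on[OF xy(2)]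
    by (intro conjI exI[of _ x] exI[of _ y]) simp_all
qed

lemma is_rs_sum_commute: "is_rs_sum r s A \<longleftrightarrow> is_rs_sum s r A"
  unfolding is_rs_sum_iff by (metis inf_commute sup_commute)

definition rs_edges :: "nat \<Rightarrow> nat \<Rightarrow> nat \<Rightarrow> nat set set" where
  "rs_edges r s n = {A. A \<subseteq> {1..n} \<and> is_rs_sum r s A}"

lemma finite_rs_edges: "finite (rs_edges r s n)"
  by (rule finite_subset[of _ "Pow {1..n}"]) (auto simp: rs_edges_def)

text \<open>An edge containing \<open>T\<close> has one further element \<open>v\<close>. The part
  \<open>X\<close> of \<open>T\<close> on the side of \<open>v\<close> determines \<open>v\<close>
  as \<open>\<Sum>(T - X) - \<Sum>X\<close>, so there are at most as many such edges as subsets of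
  \<open>T\<close>.\<close>

lemma codegree_rs_edges:
  assumes T: "finite T" "card T + 1 = r + s"
  shows "card {A \<in> rs_edges r s n. T \<subseteq> A} \<le> 2 ^ card T"
proof -
  \<comment> \<open>The subtraction is truncated, but exact for every \<open>X\<close> that arises
    from an edge.\<close>
  define f where "f X = \<Sum>(T - X) - \<Sum>X" for X :: "nat set"
  have "{A \<in> rs_edges r s n. T \<subseteq> A} \<subseteq> (\<lambda>X. insert (f X) T) ` Pow T"
  proof clarify
    fix A assume A: "A \<in> rs_edges r s n" "T \<subseteq> A"
    then have "is_rs_sum r s A" by (simp add: rs_edges_def)
    then obtain P Q where PQ: "A = P \<union> Q" "P \<inter> Q = {}" "finite P" "finite Q" "card P = r" "card Q = s"
      "\<Sum>P = \<Sum>Q" unfolding is_rs_sum_iff by blast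
    have "card (A - T) = 1"
      using PQ A(2) T by (subst card_Diff_subset) (auto simp: card_Un_disjoint)
    then obtain v where v: "A - T = {v}" by (auto simp: card_1_singleton_iff)
    have main: "insert (f (X - {v})) T = A"
      if X: "v \<in> X" "v \<notin> Y" "A = X \<union> Y" "X \<inter> Y = {}" "finite X" "\<Sum>X = \<Sum>Y" for X Y
    proof -
      have Y: "T - (X - {v}) = Y" using v X A(2) by auto
      have "\<Sum>X = v + \<Sum>(X - {v})" using X by (simp add: sum.remove)
      then have "f (X - {v}) = v" using X(6) by (simp add: f_def Y)
      then show ?thesis using v A(2) by auto
    qed
    have vA: "v \<in> P \<union> Q" using v PQ(1) by auto
    show "A \<in> (\<lambda>X. insert (f X) T) ` Pow T"
    proof (cases "v \<in> P")
      case True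
      then have "insert (f (P - {v})) T = A" using PQ by (intro main[of P Q]) auto
      moreover have "P - {v} \<subseteq> T" using v PQ(1) by auto
      ultimately show ?thesis by blast
    next
      case False
      then have "insert (f (Q - {v})) T = A" using PQ vA by (intro main[of Q P]) auto
      moreover have "Q - {v} \<subseteq> T" using v PQ(1) by auto
      ultimately show ?thesis by blast
    qed
  qed
  then have "card {A \<in> rs_edges r s n. T \<subseteq> A} \<le> card (Pow T)"
    using T(1) by (meson card_image_le card_mono finite_Pow_iff finite_imageI le_trans)
  then show ?thesis using T(1) by (simp add: card_Pow)
qed

section \<open>A lower bound of order \<open>n ^ (r + s - 1)\<close> for the number of sums\<close>

lemma split_sum_less:
  fixes T :: "nat set"
  assumes "finite T" "\<And>t. t \<in> T \<Longrightarrow> 0 < t" "card T = a + b" "a \<le> b" "1 \<le> b"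
  shows "\<exists>P Q. T = P \<union> Q \<and> P \<inter> Q = {} \<and> card P = a \<and> card Q = b \<and> \<Sum>P < \<Sum>Q"
  using assms
proof (induction a arbitrary: b T)
  case 0
  then have "T \<noteq> {}" by auto
  then have "0 < \<Sum>T" using 0 by (intro sum_pos) auto
  then show ?case using 0 by (intro exI[of _ "{}"] exI[of _ T]) auto
next
  case (Suc a)
  then obtain b' where b: "b = Suc b'" by (cases b) auto
  \<comment> \<open>The smallest element joins \<open>P\<close>, the largest joins \<open>Q\<close>,
    and the rest is split by induction. Since \<open>u < w\<close> provides strictness, a weak
    inequality suffices for the rest, which covers the empty rest as well.\<close>
  define u w where "u = Min T" and "w = Max T"
  have "T \<noteq> {}" using Suc.prems by auto
  then have uw: "u \<in> T" "w \<in> T" "u \<le> w" using Suc.prems(1) by (auto simp: u_def w_def)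
  have "u \<noteq> w"
  proof
    assume "u = w"
    have "t = u" if "t \<in> T" for t
      using Min_le[OF Suc.prems(1) that] Max_ge[OF Suc.prems(1) that] \<open>u = w\<close>
      unfolding u_def w_def by linarith
    then have "T \<subseteq> {u}" by blast
    then have "card T \<le> 1" using card_mono[of "{u}" T] by simp
    then show False using Suc.prems b by simp
  qed
  then have less: "u < w" using uw by simp
  let ?T = "T - {u, w}"
  have cT: "card ?T = a + b'"
    using uw \<open>u \<noteq> w\<close> Suc.prems b by (subst card_Diff_subset) auto
  obtain P Q where PQ: "?T = P \<union> Q" "P \<inter> Q = {}" "card P = a" "card Q = b'" "\<Sum>P \<le> \<Sum>Q"
  proof (cases "b' = 0")
    case True
    then have "a = 0" "?T = {}" using Suc.prems b cT by auto
    then show ?thesis using that[of "{}" "{}"] True by simp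
  next
    case False
    then have "\<exists>P Q. ?T = P \<union> Q \<and> P \<inter> Q = {} \<and> card P = a \<and> card Q = b' \<and> \<Sum>P < \<Sum>Q"
      using Suc.prems b cT by (intro Suc.IH) auto
    then obtain P Q where "?T = P \<union> Q" "P \<inter> Q = {}" "card P = a" "card Q = b'" "\<Sum>P < \<Sum>Q"
      by blast
    then show ?thesis by (intro that[of P Q]) simp_all
  qed
  have fin: "finite P" "finite Q" using PQ(1) Suc.prems(1) by (metis finite_Diff finite_Un)+
  have nin: "u \<notin> P \<union> Q" "w \<notin> P \<union> Q" using PQ(1) by auto
  show ?case
  proof (intro exI conjI)
    show "T = insert u P \<union> insert w Q" using PQ(1) uw by auto
    show "insert u P \<inter> insert w Q = {}" using PQ(2) nin \<open>u \<noteq> w\<close> by auto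
    show "card (insert u P) = Suc a" "card (insert w Q) = b" using fin nin PQ b by auto
    show "\<Sum>(insert u P) < \<Sum>(insert w Q)" using fin nin PQ(5) less by simp
  qed
qed

text \<open>An edge is built from \<open>r + s - 2\<close> small elements and one large element \<open>x\<close>: if the small ones
  are distributed so that the side of \<open>x\<close> has the smaller sum, the missing element lies just
  below \<open>x\<close>.\<close>

lemma card_rs_edges_ge_choose:
  assumes "1 \<le> r" "r \<le> s" "2 \<le> s" "(s * (r + s) + 1) * m \<le> n"
  shows "(m choose (r + s - 2)) * m \<le> card (rs_edges r s n)"
proof -
  \<comment> \<open>The large element exceeds \<open>N \<ge> s * m\<close>, which leaves room for
    the missing element \<open>y\<close> strictly between \<open>m\<close> and
    \<open>x\<close>.\<close>
  define N where "N = s * (r + s) * m"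
  define I where "I = {T. T \<subseteq> {1..m} \<and> card T = r + s - 2} \<times> {N + 1..N + m}"
  have Nm: "N + m \<le> n" using assms(4) by (simp add: N_def algebra_simps)
  have "\<exists>A. A \<in> rs_edges r s n \<and> A \<inter> {1..m} = T \<and> Max A = x" if "(T, x) \<in> I" for T x
  proof -
    have T: "T \<subseteq> {1..m}" "card T = (r - 1) + (s - 1)" "finite T"
      and x: "N < x" "x \<le> n"
      using that assms Nm by (auto simp: I_def intro: finite_subset)
    have "\<exists>P Q. T = P \<union> Q \<and> P \<inter> Q = {} \<and> card P = r - 1 \<and> card Q = s - 1 \<and> \<Sum>P < \<Sum>Q"
      using T assms by (intro split_sum_less) auto
    then obtain P Q where PQ: "T = P \<union> Q" "P \<inter> Q = {}" "card P = r - 1" "card Q = s - 1" "\<Sum>P < \<Sum>Q"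
      by blast
    have fin: "finite P" "finite Q" using T(3) PQ(1) by auto
    have "\<Sum>Q \<le> of_nat (card Q) * m"
      by (intro sum_bounded_above) (use PQ(1) T(1) in auto)
    then have "\<Sum>Q \<le> (s - 1) * m" using PQ(4) by simp
    also have "(s - 1) * m + m = s * m" using assms by (cases s) auto
    finally have Q: "\<Sum>Q + m \<le> s * m" by simp
    have "s * m * 1 \<le> s * m * (r + s)" using assms by (intro mult_left_mono) auto
    then have sN: "s * m \<le> N" by (simp add: N_def mult_ac)
    define y where "y = x + \<Sum>P - \<Sum>Q"
    have y: "y + \<Sum>Q = x + \<Sum>P" "y < x" "m < y"
      using Q sN x PQ(5) by (auto simp: y_def)
    have mN: "m < x" using Q sN x by linarith
    have small: "t \<le> m" if "t \<in> T" for t using that T(1) by auto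
    have nin: "x \<notin> T" "y \<notin> T" using small[of x] small[of y] y mN by auto
    define A where "A = insert x P \<union> insert y Q"
    have A: "A = insert x (insert y T)" by (auto simp: A_def PQ(1))
    have "is_rs_sum r s A" unfolding is_rs_sum_iff
    proof (intro exI conjI)
      show "A = insert x P \<union> insert y Q" by (rule A_def)
      show "insert x P \<inter> insert y Q = {}" using PQ(1,2) nin y by auto
      show "card (insert x P) = r" "card (insert y Q) = s" using fin nin PQ assms by auto
      show "\<Sum>(insert x P) = \<Sum>(insert y Q)" using fin nin PQ(1) y(1) by simp
    qed (use fin in auto)
    moreover have "A \<subseteq> {1..n}" using A T(1) x y mN Nm by auto
    moreover have "A \<inter> {1..m} = T" using A T(1) y mN by auto
    moreover have "Max A = x" unfolding A using T(3) small y mN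
      by (intro Max_eqI) (auto dest!: small)
    ultimately show ?thesis by (auto simp: rs_edges_def)
  qed
  \<comment> \<open>The edge determines \<open>T\<close> as its part in \<open>{1..m}\<close> and
    \<open>x\<close> as its maximum, so the chosen map is injective.\<close>
  then have "\<forall>z\<in>I. \<exists>A. A \<in> rs_edges r s n \<and> A \<inter> {1..m} = fst z \<and> Max A = snd z" by auto
  from bchoice[OF this] obtain g
    where g: "\<And>z. z \<in> I \<Longrightarrow> g z \<in> rs_edges r s n \<and> g z \<inter> {1..m} = fst z \<and> Max (g z) = snd z"
    by blast
  have "inj_on g I"
  proof (intro inj_onI prod_eqI)
    fix a b assume "a \<in> I" "b \<in> I" "g a = g b"
    then show "fst a = fst b" "snd a = snd b" using g[of a] g[of b] by simp_all
  qed
  moreover have "g ` I \<subseteq> rs_edges r s n" using g by auto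
  ultimately have "card I \<le> card (rs_edges r s n)"
    using finite_rs_edges by (intro card_inj_on_le) auto
  moreover have "card I = (m choose (r + s - 2)) * m"
    by (simp add: I_def card_cartesian_product n_subsets)
  ultimately show ?thesis by simp
qed

text \<open>By symmetry \<open>r \<le> s\<close>, and then \<open>2 \<le> s\<close>. The
  construction is used with \<open>m = n div d\<close>, which is of order \<open>n\<close>, and
  \<open>m choose a\<close> is at least \<open>(m / a) ^ a\<close>.\<close>

lemma card_rs_edges_ge:
  assumes "1 \<le> r" "1 \<le> s" "3 \<le> r + s"
  shows "\<exists>c>0. \<exists>n1. \<forall>n\<ge>n1. c * real n ^ (r + s - 1) \<le> card (rs_edges r s n)"
proof -
  have *: "\<exists>c>0. \<exists>n1. \<forall>n\<ge>n1. c * real n ^ (r + s - 1) \<le> card (rs_edges r s n)"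
    if rs: "1 \<le> r" "r \<le> s" "2 \<le> s" for r s
  proof -
    define d where "d = s * (r + s) + 1"
    define a where "a = r + s - 2"
    have a: "1 \<le> a" "r + s - 1 = Suc a" using rs by (auto simp: a_def)
    define c where "c = 1 / (real a ^ a * (2 * d) ^ Suc a)"
    have d0: "0 < d" by (simp add: d_def)
    have "0 < c" unfolding c_def using a d0
      by (intro divide_pos_pos mult_pos_pos zero_less_power) simp_all
    moreover have "c * real n ^ (r + s - 1) \<le> card (rs_edges r s n)" if n: "n \<ge> d * a" for n
    proof -
      define m where "m = n div d"
      have ma: "a \<le> m" unfolding m_def using n d0 by (simp add: less_eq_div_iff_mult_less_eq mult.commute)
      have dm: "d * m \<le> n" by (simp add: m_def)
      have "n < d * (m + 1)" unfolding m_def using d0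
        by (metis Suc_eq_plus1 dividend_less_times_div mult_Suc_right add.commute)
      also have "\<dots> \<le> d * (2 * m)" using ma a by (intro mult_left_mono) auto
      finally have "real n \<le> real (d * (2 * m))" by (simp only: of_nat_le_iff less_imp_le)
      then have nm: "real n / (2 * d) \<le> m" using d0 by (simp add: field_simps)
      have "c * real n ^ (r + s - 1) = (real n / (2 * d)) ^ Suc a / real a ^ a"
        unfolding c_def a(2) by (simp add: power_divide)
      also have "\<dots> \<le> real m ^ Suc a / real a ^ a"
        using nm by (intro divide_right_mono power_mono) auto
      also have "\<dots> = (real m / real a) ^ a * m" by (simp add: power_divide)
      also have "\<dots> \<le> real (m choose a) * m"
        using binomial_ge_n_over_k_pow_k[OF ma, where 'a=real] by (intro mult_right_mono) auto
      also have "\<dots> = real ((m choose (r + s - 2)) * m)" by (simp add: a_def)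
      also have "\<dots> \<le> card (rs_edges r s n)"
        using card_rs_edges_ge_choose[OF rs, of m n] dm unfolding d_def
        by (simp only: of_nat_le_iff)
      finally show ?thesis .
    qed
    ultimately show ?thesis by blast
  qed
  show ?thesis
  proof (cases "r \<le> s")
    case True
    then show ?thesis using assms by (intro *) auto
  next
    case False
    have "rs_edges r s = rs_edges s r" by (auto simp: rs_edges_def is_rs_sum_commute[of r s])
    then show ?thesis using *[of s r] False assms by (simp add: add.commute)
  qed
qed

section \<open>Uniform tail bounds\<close>

text \<open>Absorbs the prefactor \<open>a\<close>: if \<open>b * x \<le> d + ln a\<close>, the
  constant bound \<open>exp (- d)\<close> suffices; otherwise \<open>b * x - ln a\<close> is at
  least a fixed proportion of \<open>b * x\<close>.\<close>

lemma exp_bound_combine: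
  fixes x a b d P :: real
  assumes "1 \<le> a" "0 < b" "0 < d" "P \<le> a * exp (- b * x)" "P \<le> exp (- d)"
  shows "P \<le> exp (- (b * d / (d + ln a)) * x)"
proof -
  define g where "g = d + ln a"
  have g: "0 < g" using assms by (auto simp: g_def add_pos_nonneg)
  show ?thesis
  proof (cases "b * x \<le> g")
    case True
    have "b * d / g * x = (b * x) * (d / g)" by simp
    also have "\<dots> \<le> g * (d / g)" using True assms g by (intro mult_right_mono) auto
    finally have "b * d / g * x \<le> d" using g by simp
    then show ?thesis using assms(5) unfolding g_def by (elim order_trans) simp
  next
    case False
    have "ln a = g * (ln a / g)" using g by simp
    also have "\<dots> \<le> b * x * (ln a / g)" using False assms g by (intro mult_right_mono) auto
    also have "\<dots> = b * x - b * d / g * x"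
    proof -
      have eq: "ln a = g - d" by (simp add: g_def)
      show ?thesis unfolding eq using g by (simp add: field_simps)
    qed
    finally have "ln a - b * x \<le> - (b * d / g) * x" by simp
    moreover have "a * exp (- b * x) = exp (ln a - b * x)" using assms by (simp add: exp_diff exp_minus field_simps)
    ultimately show ?thesis using assms(4) unfolding g_def by (smt (verit) exp_le_cancel_iff)
  qed
qed

lemma powr_root_power:
  assumes "0 < (x::real)" "0 < (j::nat)"
  shows "(x powr (1 / real j)) ^ j = x"
  using assms by (simp add: powr_powr flip: powr_realpow)

text \<open>Stated outside the locale so that \<open>c\<close> is fixed before \<open>V\<close>,
  \<open>H\<close> and \<open>p\<close>. For large \<open>\<mu>\<close> the prefactors in
  \<open>upper_tail_sum\<close> are absorbed with the help of Markov's bound; for bounded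
  \<open>\<mu>\<close> Markov's bound suffices alone.\<close>

lemma upper_tail_uniform:
  fixes \<epsilon> B :: real and k K :: nat
  assumes "0 < \<epsilon>" "0 < B" "2 \<le> k"
  shows "\<exists>c>0. \<forall>(V :: 'a set) H p. codegree_hypergraph V H k K p
    \<and> 0 < codegree_hypergraph.\<mu> H k p
    \<and> codegree_hypergraph.\<nu> V k K p \<le> B * codegree_hypergraph.\<mu> H k p
    \<and> k \<le> codegree_hypergraph.np V p
    \<longrightarrow> avg p V (\<lambda>S. of_bool ((1 + \<epsilon>) * codegree_hypergraph.\<mu> H k p \<le> codegree_hypergraph.e H S))
      \<le> exp (- c * min (codegree_hypergraph.\<mu> H k p)
          (codegree_hypergraph.\<mu> H k p powr (1 / real (k - 1)) * ln (1 / p)))"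
proof -
  \<comment> \<open>\<open>W1\<close> and \<open>W2\<close> add up the reciprocals of all upper
    bounds imposed on \<open>c1\<close> and \<open>c2\<close>, so their inverses meet all these
    bounds at once.\<close>
  define W1 where "W1 = 1 + 2 * k\<^sup>2 * K + 8 * k ^ 3 * B * K / \<epsilon> + 8 * k / \<epsilon> + 256 * k ^ 4 * B * K / \<epsilon>\<^sup>2"
  define W2 where "W2 = 1 + 16 * K / \<epsilon> + K + 32 * k * B * K / \<epsilon>"
  define c1 c2 where "c1 = 1 / W1" and "c2 = 1 / W2"
  define \<gamma> where "\<gamma> = 1 / real (k - 1)"
  define \<eta> where "\<eta> = (1 + \<epsilon> / 2) / (1 + \<epsilon>)"
  define b where "b = min (c1 * (- ln \<eta>)) (\<gamma> * c2 / (8 * k))"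
  define d where "d = ln (1 + \<epsilon>)"
  \<comment> \<open>\<open>Y\<close> bounds \<open>\<mu>\<close> whenever
    \<open>4 * k \<le> c2 * m\<close> fails.\<close>
  define Y where "Y = (4 * k / c2) ^ (k - 1)"
  define c where "c = min (b * d / (d + ln (1 / \<eta> + 1))) (d / Y)"
  have nn: "0 \<le> real (2 * k\<^sup>2 * K)" "0 \<le> 8 * k ^ 3 * B * K / \<epsilon>" "0 \<le> 8 * k / \<epsilon>"
    "0 \<le> 256 * k ^ 4 * B * K / \<epsilon>\<^sup>2" "0 \<le> 16 * K / \<epsilon>" "0 \<le> 32 * k * B * K / \<epsilon>"
    using assms by simp_all
  have W: "1 \<le> W1" "1 \<le> W2" unfolding W1_def W2_def using nn by linarith+
  have c12: "0 < c1" "0 < c2" "c2 \<le> 1" using W by (simp_all add: c1_def c2_def)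
  have quot: "x * (1 / w) \<le> y" if "x / y \<le> w" "0 < y" "1 \<le> w" for x y w :: real
    using that by (simp add: field_simps)
  have c1: "2 * k\<^sup>2 * K * c1 \<le> 1" "8 * k ^ 3 * B * K * c1 \<le> \<epsilon>" "8 * k * c1 \<le> \<epsilon>"
    "256 * k ^ 4 * B * K * c1 \<le> \<epsilon>\<^sup>2"
    unfolding c1_def using nn W assms(1)
    by (intro quot; simp add: W1_def del: of_nat_mult of_nat_power of_nat_numeral; fail)+
  have c2: "16 * K * c2 \<le> \<epsilon>" "K * c2 \<le> 1" "32 * k * B * K * c2 \<le> \<epsilon>"
    unfolding c2_def using nn W assms(1)
    by (intro quot; simp add: W2_def del: of_nat_mult of_nat_power of_nat_numeral; fail)+
  have \<eta>: "0 < \<eta>" "\<eta> < 1" using assms by (auto simp: \<eta>_def field_simps)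
  have \<gamma>: "0 < \<gamma>" using assms by (simp add: \<gamma>_def)
  have "0 < c1 * (- ln \<eta>)" using \<eta> c12 by (intro mult_pos_pos) auto
  then have b: "0 < b" using c12 \<gamma> assms by (auto simp: b_def)
  have d: "0 < d" using assms by (simp add: d_def)
  have Y: "0 < Y" using c12 assms by (auto simp: Y_def)
  have "0 < ln (1 / \<eta> + 1)" using \<eta> by (intro ln_gt_zero) simp
  then have c0: "0 < c" using b d Y by (auto simp: c_def intro!: divide_pos_pos add_pos_pos)
  show ?thesis
  proof (intro exI[of _ c] conjI c0 allI impI, elim conjE)
    fix V :: "'a set" and H p
    assume hyp: "codegree_hypergraph V H k K p"
    interpret codegree_hypergraph V H k K p by (rule hyp)
    assume mu: "0 < \<mu>" and nu: "\<nu> \<le> B * \<mu>" and knp: "k \<le> np"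
    define m where "m = \<mu> powr \<gamma>"
    define \<Phi> where "\<Phi> = min \<mu> (m * ln (1 / p))"
    define P where "P = avg p V (\<lambda>S. of_bool ((1 + \<epsilon>) * \<mu> \<le> e S))"
    have \<Phi>: "0 \<le> \<Phi>" "\<Phi> \<le> \<mu>" using mu p_pos p_le_1 by (simp_all add: \<Phi>_def m_def)
    have "exp (- d) = 1 / (1 + \<epsilon>)" using assms by (simp add: d_def exp_minus inverse_eq_divide)
    then have Pd: "P \<le> exp (- d)" using Markov_upper_tail[OF assms(1) mu] by (simp add: P_def)
    have "P \<le> exp (- c * \<Phi>)"
    proof (cases "4 * k \<le> c2 * m")
      case True
      have "P \<le> 1 / \<eta> * \<eta> powr (c1 * \<Phi>) + exp (- (\<gamma> * c2 / (8 * k)) * \<Phi>)"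
        unfolding P_def \<Phi>_def m_def \<gamma>_def \<eta>_def
        by (rule upper_tail_sum[OF assms(1) mu nu knp c12(1) c1 c12(2,3) c2 True[unfolded m_def \<gamma>_def]])
      also have "\<eta> powr (c1 * \<Phi>) = exp (- (c1 * (- ln \<eta>)) * \<Phi>)" using \<eta> by (simp add: powr_def)
      also have "1 / \<eta> * exp (- (c1 * (- ln \<eta>)) * \<Phi>) + exp (- (\<gamma> * c2 / (8 * k)) * \<Phi>)
          \<le> 1 / \<eta> * exp (- b * \<Phi>) + exp (- b * \<Phi>)"
      proof -
        have "b * \<Phi> \<le> c1 * (- ln \<eta>) * \<Phi>" "b * \<Phi> \<le> \<gamma> * c2 / (8 * k) * \<Phi>"
          using \<Phi>(1) unfolding b_def by (intro mult_right_mono; simp)+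
        then show ?thesis using \<eta> by (intro add_mono mult_left_mono) simp_all
      qed
      also have "\<dots> = (1 / \<eta> + 1) * exp (- b * \<Phi>)" by (simp add: algebra_simps)
      finally have "P \<le> exp (- (b * d / (d + ln (1 / \<eta> + 1))) * \<Phi>)"
        using \<eta> b d Pd by (intro exp_bound_combine) auto
      moreover have "c * \<Phi> \<le> b * d / (d + ln (1 / \<eta> + 1)) * \<Phi>"
        using \<Phi>(1) unfolding c_def by (intro mult_right_mono) simp_all
      ultimately have "P \<le> exp (- c * \<Phi>)" by (elim order_trans) simp
      then show ?thesis .
    next
      case False
      have "m ^ (k - 1) = \<mu>" using powr_root_power[OF mu, of "k - 1"] assms by (simp add: m_def \<gamma>_def)
      moreover have "m ^ (k - 1) \<le> (4 * k / c2) ^ (k - 1)"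
        using False c12 by (intro power_mono) (auto simp: field_simps m_def)
      ultimately have "\<Phi> \<le> Y" using \<Phi> by (simp add: Y_def)
      have "c * \<Phi> \<le> d / Y * \<Phi>" using \<Phi> by (intro mult_right_mono) (auto simp: c_def)
      also have "\<dots> \<le> d / Y * Y" using \<open>\<Phi> \<le> Y\<close> d Y by (intro mult_left_mono) auto
      finally have "c * \<Phi> \<le> d" using Y by simp
      then show ?thesis using Pd by (elim order_trans) simp
    qed
    then show "avg p V (\<lambda>S. of_bool ((1 + \<epsilon>) * \<mu> \<le> e S))
      \<le> exp (- c * min \<mu> (\<mu> powr (1 / real (k - 1)) * ln (1 / p)))"
      unfolding P_def \<Phi>_def m_def \<gamma>_def .
  qed
qed

context codegree_hypergraph
begin

text \<open>When \<open>\<mu>\<close> is the smaller term of the rate, it is polylogarithmic in \<open>1 / p\<close>, so that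
  intersecting pairs of edges have bounded expected number.\<close>

lemma pair_weight_bounded:
  fixes \<epsilon> B :: real
  defines "N \<equiv> 4 * (k - 1)"
  assumes k: "3 \<le> k" and eps: "0 < \<epsilon>" and mu: "1 \<le> (1 + \<epsilon>) * \<mu>" and nu: "\<nu> \<le> B * \<mu>" and knp: "k \<le> np"
    and small: "\<mu> \<le> \<mu> powr (1 / real (k - 1)) * ln (1 / p)"
  shows "\<mu> * (k * \<nu> * k / np) \<le> k\<^sup>2 * B * (1 + (1 + \<epsilon>) * K * real N ^ N)"
proof -
  define h where "h = ln (1 / p)"
  define j where "j = k - 1"
  have j: "2 \<le> j" "N = 4 * j" using k by (auto simp: j_def N_def)
  have h: "0 \<le> h" using p_pos p_le_1 by (simp add: h_def)
  have mu0: "0 < \<mu>" using mu eps by (smt (verit) mult_nonneg_nonpos)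
  have np0: "0 < np" using knp k by linarith
  have B0: "0 < B" using nu \<mu>_le_\<nu> mu0 by (smt (verit) mult_nonpos_nonneg)
  \<comment> \<open>This is where \<open>3 \<le> k\<close> enters: for \<open>\<mu> > 1\<close> the
    exponent \<open>1 / (k - 1)\<close> is at most \<open>1 / 2\<close>, so the hypothesis yields
    \<open>\<mu> powr (1 / 2) \<le> h\<close>.\<close>
  have "\<mu> \<le> (1 + h)\<^sup>2"
  proof (cases "\<mu> \<le> 1")
    case True
    have "1 ^ 2 \<le> (1 + h) ^ 2" using h by (intro power_mono) auto
    then show ?thesis using True by simp
  next
    case False
    have "\<mu> powr (1 / real (k - 1)) \<le> \<mu> powr (1 / 2)"
      using False k by (intro powr_mono) (auto simp: field_simps)
    then have "\<mu> \<le> \<mu> powr (1 / 2) * h"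
      using small h by (smt (verit) h_def mult_right_mono)
    moreover have "\<mu> = \<mu> powr (1 / 2) * \<mu> powr (1 / 2)" using mu0 by (simp flip: powr_add)
    ultimately have "\<mu> powr (1 / 2) * \<mu> powr (1 / 2) \<le> \<mu> powr (1 / 2) * h" by simp
    then have "\<mu> powr (1 / 2) \<le> 1 + h" using mu0 by simp
    then have "\<mu> powr (1 / 2) * \<mu> powr (1 / 2) \<le> (1 + h) * (1 + h)"
      using h by (intro mult_mono) auto
    then show ?thesis using \<open>\<mu> = _\<close> by (simp add: power2_eq_square)
  qed
  then have "\<mu>\<^sup>2 \<le> ((1 + h)\<^sup>2)\<^sup>2" using mu0 by (intro power_mono) auto
  then have mu2: "\<mu>\<^sup>2 \<le> (1 + h) ^ 4" by (simp flip: power_mult)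
  \<comment> \<open>Up to constants \<open>y\<close> bounds the pair weight. In its
    \<open>j\<close>-th power the factor \<open>1 / np ^ j\<close> is at most of order
    \<open>p\<close>, while the power \<open>(1 + h) ^ N\<close> costs at most
    \<open>N ^ N * exp h = N ^ N / p\<close>.\<close>
  define y where "y = \<mu>\<^sup>2 / np"
  have y0: "0 \<le> y" using np0 by (simp add: y_def)
  have "y ^ j \<le> (1 + \<epsilon>) * K * real N ^ N"
  proof -
    have "1 \<le> (1 + \<epsilon>) * \<nu>" using mu \<mu>_le_\<nu> eps by (smt (verit) mult_left_mono)
    then have np_j: "1 / np ^ j \<le> (1 + \<epsilon>) * K * p"
      using np0 unfolding \<nu>_eq j_def by (simp add: field_simps)
    have "y ^ j = (\<mu>\<^sup>2) ^ j * (1 / np ^ j)" by (simp add: y_def power_divide)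
    also have "\<dots> \<le> ((1 + h) ^ 4) ^ j * ((1 + \<epsilon>) * K * p)"
      using mu2 np_j np0 h by (intro mult_mono power_mono) auto
    also have "((1 + h) ^ 4) ^ j = (1 + h) ^ N" by (simp add: j(2) flip: power_mult)
    also have "(1 + h) ^ N \<le> real N ^ N * (1 / p)"
    proof -
      have N: "1 \<le> N" using j by simp
      have "(1 + h) ^ N \<le> (real N * (1 + h / N)) ^ N"
        using h N by (intro power_mono) (auto simp: field_simps)
      also have "\<dots> = real N ^ N * (1 + h / N) ^ N" by (simp add: power_mult_distrib)
      also have "\<dots> \<le> real N ^ N * exp h"
        using h N by (intro mult_left_mono exp_ge_one_plus_x_over_n_power_n) auto
      finally show ?thesis using p_pos by (simp add: h_def)
    qed
    finally have "y ^ j \<le> real N ^ N * (1 / p) * ((1 + \<epsilon>) * K * p)"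
      using eps p_pos by (simp add: mult_right_mono)
    then show ?thesis using p_pos by (simp add: mult_ac)
  qed
  moreover have "y \<le> 1 + y ^ j"
  proof (cases "y \<le> 1")
    case True
    then show ?thesis using y0 by (smt (verit) zero_le_power)
  next
    case False
    then have "y ^ 1 \<le> y ^ j" using j by (intro power_increasing) auto
    then show ?thesis by simp
  qed
  ultimately have y: "y \<le> 1 + (1 + \<epsilon>) * K * real N ^ N" by linarith
  have "\<mu> * (k * \<nu> * k / np) = (k\<^sup>2 * \<mu> / np) * \<nu>" by (simp add: power2_eq_square)
  also have "\<dots> \<le> (k\<^sup>2 * \<mu> / np) * (B * \<mu>)" using nu mu0 np0 by (intro mult_left_mono) auto
  also have "\<dots> = k\<^sup>2 * B * y" by (simp add: y_def power2_eq_square)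
  also have "\<dots> \<le> k\<^sup>2 * B * (1 + (1 + \<epsilon>) * K * real N ^ N)"
    using y B0 by (intro mult_left_mono) auto
  finally show ?thesis .
qed

end

section \<open>Specialization to sums, the interval lower bound and the final estimate\<close>

lemma codegree_hypergraph_rs_edges:
  assumes "1 \<le> r" "1 \<le> s" "3 \<le> r + s" "0 < p" "p \<le> 1"
  shows "codegree_hypergraph {1..n} (rs_edges r s n) (r + s) (2 ^ (r + s - 1)) p"
proof
  show "card A = r + s" if "A \<in> rs_edges r s n" for A
    using that by (simp add: rs_edges_def is_rs_sum_def)
  show "card {A \<in> rs_edges r s n. T \<subseteq> A} \<le> 2 ^ (r + s - 1)"
    if T: "T \<subseteq> {1..n}" "card T = r + s - 1" for T
  proof -
    have "finite T" using T(1) finite_subset by blast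
    then show ?thesis using codegree_rs_edges[of T r s n] T assms by simp
  qed
qed (use assms in \<open>auto simp: rs_edges_def\<close>)

text \<open>With probability \<open>p ^ m\<close> the random set contains \<open>{1..m}\<close> and
  hence all edges of that interval. The least \<open>m\<close> that provides \<open>a\<close> edges
  is of order \<open>a powr \<gamma>\<close>, because \<open>{1..m - 1}\<close> has fewer than
  \<open>a\<close> edges.\<close>

lemma lower_tail_interval:
  fixes a u c0 p :: real and n1 :: nat
  assumes rs: "1 \<le> r" "1 \<le> s" "3 \<le> r + s" and p: "0 < p" "p \<le> 1"
    and c0: "0 < c0" "\<And>n. n1 \<le> n \<Longrightarrow> c0 * real n ^ (r + s - 1) \<le> card (rs_edges r s n)"
    and a: "0 < u" "u \<le> a" "a \<le> card (rs_edges r s n)"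
  defines "\<gamma> \<equiv> 1 / real (r + s - 1)"
  shows "exp (- ((n1 + 1) / u powr \<gamma> + (1 / c0) powr \<gamma>) * (a powr \<gamma> * ln (1 / p)))
    \<le> avg p {1..n} (\<lambda>S. of_bool (a \<le> num_rs_sums r s S))"
proof -
  have \<gamma>: "0 < \<gamma>" using rs by (simp add: \<gamma>_def)
  define m where "m = (LEAST m. a \<le> card (rs_edges r s m))"
  have m: "a \<le> card (rs_edges r s m)" unfolding m_def by (rule LeastI[of _ n]) (rule a(3))
  have mn: "m \<le> n" unfolding m_def by (rule Least_le) (rule a(3))
  have m_le: "m \<le> ((n1 + 1) / u powr \<gamma> + (1 / c0) powr \<gamma>) * a powr \<gamma>"
  proof -
    \<comment> \<open>The lower bound \<open>u\<close> on \<open>a\<close> turns the additive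
      constant \<open>n1 + 1\<close> into a multiple of \<open>a powr \<gamma>\<close>.\<close>
    have u: "1 \<le> a powr \<gamma> / u powr \<gamma>"
      using a \<gamma> by (simp add: powr_mono2)
    have "m \<le> (n1 + 1) + (1 / c0) powr \<gamma> * a powr \<gamma>"
    proof (cases "m \<le> n1 + 1")
      case False
      then have "\<not> a \<le> card (rs_edges r s (m - 1))" 
        using not_less_Least[of "m - 1" "\<lambda>m. a \<le> card (rs_edges r s m)", folded m_def] by simp
      moreover have "c0 * real (m - 1) ^ (r + s - 1) \<le> card (rs_edges r s (m - 1))"
        using False by (intro c0) simp
      ultimately have "real (m - 1) ^ (r + s - 1) \<le> 1 / c0 * a" using c0(1) by (simp add: field_simps)
      then have "(real (m - 1) ^ (r + s - 1)) powr \<gamma> \<le> (1 / c0 * a) powr \<gamma>"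
        using \<gamma> by (intro powr_mono2) auto
      moreover have "(real (m - 1) ^ (r + s - 1)) powr \<gamma> = real (m - 1)"
        using False rs by (simp add: \<gamma>_def powr_powr flip: powr_realpow)
      moreover have "(1 / c0 * a) powr \<gamma> = (1 / c0) powr \<gamma> * a powr \<gamma>"
        using c0(1) a by (intro powr_mult)
      ultimately have "real (m - 1) \<le> (1 / c0) powr \<gamma> * a powr \<gamma>" by simp
      then show ?thesis using False by simp
    qed (simp add: add_increasing2)
    also have "real (n1 + 1) \<le> real (n1 + 1) * (a powr \<gamma> / u powr \<gamma>)"
      using mult_left_mono[OF u, of "real (n1 + 1)"] by simp
    finally show ?thesis by (simp add: algebra_simps)
  qed
  define C where "C = ((n1 + 1) / u powr \<gamma> + (1 / c0) powr \<gamma>)"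
  have "exp (- C * (a powr \<gamma> * ln (1 / p))) \<le> exp (- (m * ln (1 / p)))"
  proof -
    have "m * ln (1 / p) \<le> (C * a powr \<gamma>) * ln (1 / p)"
      using m_le p unfolding C_def by (intro mult_right_mono) auto
    then show ?thesis by (simp add: mult.assoc)
  qed
  also have "\<dots> = p powr m" using p by (simp add: powr_def ln_div)
  also have "\<dots> = p ^ m" using p by (simp add: powr_realpow)
  also have "\<dots> = avg p {1..n} (\<lambda>S. of_bool ({1..m} \<subseteq> S))" using mn by (subst avg_superset) auto
  also have "\<dots> \<le> avg p {1..n} (\<lambda>S. of_bool (a \<le> num_rs_sums r s S))"
  proof (intro avg_mono)
    fix S :: "nat set" assume S: "S \<subseteq> {1..n}"
    have "a \<le> num_rs_sums r s S" if "{1..m} \<subseteq> S"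
    proof -
      have "card (rs_edges r s m) \<le> num_rs_sums r s S" unfolding num_rs_sums_def
      proof (rule card_mono)
        show "finite {A. A \<subseteq> S \<and> is_rs_sum r s A}"
          using S by (auto intro!: finite_subset[of _ "Pow {1..n}"])
      qed (use that in \<open>auto simp: rs_edges_def\<close>)
      then show ?thesis using m by linarith
    qed
    then show "(of_bool ({1..m} \<subseteq> S) :: real) \<le> of_bool (a \<le> num_rs_sums r s S)" by simp
  qed (use p in auto)
  finally show ?thesis unfolding C_def .
qed

theorem mainTheorem6:
  fixes r s :: nat
  assumes "r \<ge> 1" and "s \<ge> 1" and "r + s \<ge> 3"
  shows "\<forall>\<epsilon>::real. \<epsilon> > 0 \<longrightarrow>
    (\<exists>c C :: real. \<exists>n0 :: nat. c > 0 \<and> C > 0 \<and>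
      (\<forall>n \<ge> n0. \<forall>p::real. 0 < p \<and> p \<le> 1 \<longrightarrow>
        (let \<mu> = expected_rs_sums n r s p;
             P = measure_pmf.prob (binomial_random_subset n p)
                   {S. real (num_rs_sums r s S) \<ge> (1 + \<epsilon>) * \<mu>};
             \<Phi> = min \<mu> (\<mu> powr (1 / real (r + s - 1)) * ln (1 / p))
         in 1 \<le> (1 + \<epsilon>) * \<mu> \<and> (1 + \<epsilon>) * \<mu> \<le> real (num_rs_sums r s {1..n}) \<longrightarrow>
            exp (- C * \<Phi>) \<le> P \<and> P \<le> exp (- c * \<Phi>))))"
proof (intro allI impI)
  fix \<epsilon> :: real assume eps: "\<epsilon> > 0"
  define k K where "k = r + s" and "K = (2::nat) ^ (r + s - 1)"
  have k: "3 \<le> k" using assms by (simp add: k_def)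
  define \<gamma> where "\<gamma> = 1 / real (k - 1)"
  obtain c0 n1 where c0: "0 < c0" "\<And>n. n1 \<le> n \<Longrightarrow> c0 * real n ^ (r + s - 1) \<le> card (rs_edges r s n)"
    using card_rs_edges_ge[OF assms] by blast
  \<comment> \<open>The factor between the codegree bound on the number of edges and the lower bound
    obtained by construction.\<close>
  define B where "B = K / c0"
  have B: "0 < B" using c0 by (simp add: B_def K_def)
  obtain c where c: "0 < c" and upper: "\<forall>(V :: nat set) H p. codegree_hypergraph V H k K p
    \<and> 0 < codegree_hypergraph.\<mu> H k p
    \<and> codegree_hypergraph.\<nu> V k K p \<le> B * codegree_hypergraph.\<mu> H k p
    \<and> k \<le> codegree_hypergraph.np V p
    \<longrightarrow> avg p V (\<lambda>S. of_bool ((1 + \<epsilon>) * codegree_hypergraph.\<mu> H k p \<le> codegree_hypergraph.e H S))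
      \<le> exp (- c * min (codegree_hypergraph.\<mu> H k p)
          (codegree_hypergraph.\<mu> H k p powr (1 / real (k - 1)) * ln (1 / p)))"
    using upper_tail_uniform[OF eps B, of k K] k by (auto simp: k_def)
  define N where "N = 4 * (k - 1)"
  define D where "D = k\<^sup>2 * B * (1 + (1 + \<epsilon>) * K * real N ^ N)"
  have D: "0 \<le> D" using B eps by (simp add: D_def)
  define b where "b = 1 / (16 * (1 + \<epsilon>)\<^sup>2 * (2 + D))"
  have b: "0 < b" using eps D by (auto simp: b_def intro!: mult_pos_pos)
  define C1 where "C1 = 2 * (1 + \<epsilon>) * \<bar>ln b\<bar>"
  \<comment> \<open>The constant of \<open>lower_tail_interval\<close> for \<open>u = 1\<close>, as
    the target \<open>(1 + \<epsilon>) * \<mu>\<close> is at least \<open>1\<close>.\<close>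
  define Q where "Q = (n1 + 1) / 1 powr \<gamma> + (1 / c0) powr \<gamma>"
  define C2 where "C2 = Q * (1 + \<epsilon>) powr \<gamma>"
  define C where "C = C1 + C2 + 1"
  have C12: "0 \<le> C1" "0 \<le> C2" using eps by (simp_all add: C1_def C2_def Q_def)
  \<comment> \<open>The second entry ensures \<open>k \<le> G.np\<close>: from
    \<open>1 \<le> (1 + \<epsilon>) * G.\<nu>\<close> follows
    \<open>n \<le> (1 + \<epsilon>) * K * G.np ^ k\<close>.\<close>
  define n0 where "n0 = max n1 (nat \<lceil>(1 + \<epsilon>) * K * real k ^ k\<rceil>)"
  have "exp (- C * min \<mu> (\<mu> powr \<gamma> * ln (1 / p))) \<le> P \<and> P \<le> exp (- c * min \<mu> (\<mu> powr \<gamma> * ln (1 / p)))"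
    if n: "n0 \<le> n" and p: "0 < p" "p \<le> 1" and \<mu>: "\<mu> = expected_rs_sums n r s p"
      and P: "P = measure_pmf.prob (binomial_random_subset n p)
                   {S. real (num_rs_sums r s S) \<ge> (1 + \<epsilon>) * \<mu>}"
      and mu: "1 \<le> (1 + \<epsilon>) * \<mu>" "(1 + \<epsilon>) * \<mu> \<le> real (num_rs_sums r s {1..n})"
    for n p \<mu> P
  proof -
    interpret G: codegree_hypergraph "{1..n}" "rs_edges r s n" k K p
      unfolding k_def K_def by (rule codegree_hypergraph_rs_edges) (use assms p in auto)
    have num_e: "num_rs_sums r s S = G.e S" if "S \<subseteq> {1..n}" for S
      unfolding num_rs_sums_def G.e_def using that
      by (intro arg_cong[of _ _ card]) (auto simp: rs_edges_def)
    have "\<mu> = avg p {1..n} (\<lambda>S. real (G.e S))"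
      unfolding \<mu> expected_rs_sums_def using p
      by (simp only: expectation_binomial_random_subset less_imp_le) (intro avg_cong, simp add: num_e)
    then have \<mu>G: "\<mu> = G.\<mu>" by (simp only: G.avg_e)
    have Pnum: "P = avg p {1..n} (\<lambda>S. of_bool ((1 + \<epsilon>) * \<mu> \<le> num_rs_sums r s S))"
      unfolding P using p by (simp add: prob_binomial_random_subset)
    have PG: "P = avg p {1..n} (\<lambda>S. of_bool ((1 + \<epsilon>) * G.\<mu> \<le> G.e S))"
      unfolding Pnum \<mu>G by (intro avg_cong) (simp only: num_e)
    have cardH: "num_rs_sums r s {1..n} = card (rs_edges r s n)"
      by (simp add: num_rs_sums_def rs_edges_def)
    have mu0: "0 < \<mu>" using mu eps by (smt (verit) mult_nonneg_nonpos)
    have h: "0 \<le> ln (1 / p)" using p by simp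
    have \<nu>_eq: "G.\<nu> = K * real n ^ (k - 1) * p ^ k" and np_eq: "G.np = n * p"
      unfolding G.\<nu>_def G.np_def by simp_all
    have nu: "G.\<nu> \<le> B * G.\<mu>"
    proof -
      have "c0 * real n ^ (k - 1) \<le> card (rs_edges r s n)"
        using c0(2)[of n] n by (simp add: n0_def k_def)
      then have "B * (c0 * real n ^ (k - 1)) * p ^ k \<le> B * card (rs_edges r s n) * p ^ k"
        using B p by (intro mult_right_mono mult_left_mono) auto
      then show ?thesis using c0(1) unfolding \<nu>_eq G.\<mu>_def by (simp add: B_def mult.assoc)
    qed
    have knp: "k \<le> G.np"
    proof -
      have "1 \<le> (1 + \<epsilon>) * G.\<nu>" using mu eps G.\<mu>_le_\<nu> unfolding \<mu>G by (smt (verit) mult_left_mono)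
      then have "real n * 1 \<le> n * ((1 + \<epsilon>) * G.\<nu>)" by (intro mult_left_mono) auto
      also have "\<dots> = (1 + \<epsilon>) * K * (real n ^ (k - 1) * real n * p ^ k)" unfolding \<nu>_eq by simp
      also have "real n ^ (k - 1) * real n = real n ^ k"
        using k by (metis Suc_diff_1 less_le_trans power_Suc2 zero_less_numeral)
      finally have "n \<le> (1 + \<epsilon>) * K * G.np ^ k" unfolding np_eq by (simp add: power_mult_distrib mult.assoc)
      moreover have "(1 + \<epsilon>) * K * real k ^ k \<le> n" using n unfolding n0_def by linarith
      ultimately have "(1 + \<epsilon>) * K * real k ^ k \<le> (1 + \<epsilon>) * K * G.np ^ k" by linarith
      then have "real k ^ k \<le> G.np ^ k" using eps by (simp add: K_def)
      then show ?thesis using G.np_nonneg k by (subst (asm) power_mono_iff) simp_all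
    qed
    have "P \<le> exp (- c * min \<mu> (\<mu> powr \<gamma> * ln (1 / p)))"
      using upper G.codegree_hypergraph_axioms mu0 nu knp unfolding PG \<mu>G \<gamma>_def by blast
    moreover have "exp (- C * min \<mu> (\<mu> powr \<gamma> * ln (1 / p))) \<le> P"
    \<comment> \<open>The smaller term of the rate decides the strategy: edges from many classes if
      it is \<open>\<mu>\<close>, a full initial interval otherwise.\<close>
    proof (cases "\<mu> \<le> \<mu> powr \<gamma> * ln (1 / p)")
      case True
      have "G.\<mu> * (k * G.\<nu> * k / G.np) \<le> D"
        unfolding D_def N_def using mu True
        by (intro G.pair_weight_bounded k eps nu knp) (simp_all add: \<mu>G \<gamma>_def)
      then have "b powr (2 * (1 + \<epsilon>) * \<mu>) \<le> P"
        unfolding PG b_def \<mu>G using mu(1) mu(2)[unfolded cardH]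
        by (intro G.lower_tail_Poisson eps knp) (simp_all add: \<mu>G)
      moreover have "exp (- C * \<mu>) \<le> b powr (2 * (1 + \<epsilon>) * \<mu>)"
      proof -
        have "- ln b * (2 * (1 + \<epsilon>) * \<mu>) \<le> \<bar>ln b\<bar> * (2 * (1 + \<epsilon>) * \<mu>)"
          using eps mu0 by (intro mult_right_mono) auto
        also have "\<dots> = C1 * \<mu>" by (simp add: C1_def)
        also have "\<dots> \<le> C * \<mu>" using C12 mu0 by (intro mult_right_mono) (auto simp: C_def)
        finally show ?thesis using b by (simp add: powr_def mult_ac)
      qed
      ultimately show ?thesis using True by simp
    next
      case False
      have "C2 * (\<mu> powr \<gamma> * ln (1 / p)) \<le> C * (\<mu> powr \<gamma> * ln (1 / p))"
        using C12 h by (intro mult_right_mono) (auto simp: C_def)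
      then have "exp (- C * (\<mu> powr \<gamma> * ln (1 / p))) \<le> exp (- C2 * (\<mu> powr \<gamma> * ln (1 / p)))" by simp
      also have "\<dots> = exp (- Q * (((1 + \<epsilon>) * \<mu>) powr \<gamma> * ln (1 / p)))"
        using eps mu0 by (simp add: C2_def powr_mult mult_ac)
      also have "\<dots> \<le> P"
        unfolding Pnum Q_def \<gamma>_def k_def using mu(1) mu(2)[unfolded cardH]
        by (intro lower_tail_interval assms p c0) simp_all
      finally show ?thesis using False by simp
    qed
    ultimately show ?thesis by simp
  qed
  then show "\<exists>c C :: real. \<exists>n0 :: nat. c > 0 \<and> C > 0 \<and>
      (\<forall>n \<ge> n0. \<forall>p::real. 0 < p \<and> p \<le> 1 \<longrightarrow>
        (let \<mu> = expected_rs_sums n r s p;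
             P = measure_pmf.prob (binomial_random_subset n p)
                   {S. real (num_rs_sums r s S) \<ge> (1 + \<epsilon>) * \<mu>};
             \<Phi> = min \<mu> (\<mu> powr (1 / real (r + s - 1)) * ln (1 / p))
         in 1 \<le> (1 + \<epsilon>) * \<mu> \<and> (1 + \<epsilon>) * \<mu> \<le> real (num_rs_sums r s {1..n}) \<longrightarrow>
            exp (- C * \<Phi>) \<le> P \<and> P \<le> exp (- c * \<Phi>)))"
    unfolding Let_def \<gamma>_def k_def using c C12
    by (intro exI[of _ c] exI[of _ C] exI[of _ n0]) (auto simp: C_def)
qed

end
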